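(* Let $r>1$ and let $f$ be a generic $C^r$ expanding map of $\mathbb{S}^1$. Then there exists a constant $C>1$, depending only on $\inf f'$ and the $C^{r-1}$ norm of $f'$, such that for any $\varepsilon>0$ and any integer $k\ge -C\log\varepsilon$ (with $k\in\mathbb{N}$), there is $N_0\in\mathbb{N}$ such that for any $N\ge N_0$, $$d_C\Big(SRB,\,(f_N^k)_*(\mathrm{Leb}_N)\Big)\le\varepsilon,$$ where $SRB$ is the SRB measure of $f$.
   Context: $\mathbb{S}^1=\mathbb{R}/\mathbb{Z}$, identified with $[0,1[$; $\mathbb{N}=\{0,1,2,\dots\}$. A $C^r$ expanding map of $\mathbb{S}^1$ is a $C^r$ map $f:\mathbb{S}^1\to\mathbb{S}^1$ with $f'(x)>1$ for every $x$ (for non-integer $r$, $C^r$ means $C^{\lfloor r\rfloor}$ with $\lfloor r\rfloor$-th derivative Hölder of exponent $r-\lfloor r\rfloor$). A property holds for a generic $C^r$ expanding map if it holds on a set containing a countable intersection of open dense subsets of the space of $C^r$ expanding maps with the $C^r$ topology. For $r>1$, the SRB measure of a $C^r$ expanding map $f$ is its unique $f$-invariant probability measure that is absolutely continuous with respect to Lebesgue measure. Discretization: for $N\ge1$, $E_N=\{i/N : 0\le i\le N-1\}\subset\mathbb{S}^1$; $P_N:\mathbb{S}^1\to E_N$ is a projection on a nearest point of $E_N$ (with a choice made once for all in case of ties); $f_N:E_N\to E_N$ is $f_N(x)=P_N(f(x))$, and $f_N^k$ is its $k$-th iterate. $\mathrm{Leb}_N$ is the uniform probability measure on $E_N$. Cramér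 distance: for probability measures $\mu,\nu$ on $\mathbb{S}^1\simeq[0,1[$ with cumulative distribution functions $F,G$, and $H=F-G$, $$d_C(\mu,\nu)=\Big(\min_{c\in\mathbb{R}}\int_0^1(H(x)-c)^2\,\mathrm{d}x\Big)^{1/2}.$$ *)

theory Defs
  imports "HOL-Probability.Probability"
begin

section \<open>The circle\<close>

quotient_type circle = real / "\<lambda>x y :: real. x - y \<in> \<int>"
  morphisms rep_circle to_circle
proof (rule equivpI)
  show "reflp (\<lambda>x y :: real. x - y \<in> \<int>)"
    by (simp add: reflp_def)
  show "symp (\<lambda>x y :: real. x - y \<in> \<int>)"
    using Ints_minus by (fastforce intro!: sympI)
  show "transp (\<lambda>x y :: real. x - y \<in> \<int>)"
    using Ints_add by (fastforce intro!: transpI)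
qed

lift_definition circle_coord :: "circle \<Rightarrow> real" is frac
  by (metis Ints_cases add.commute diff_add_cancel frac_add_of_int_right)

lemma circle_coord_bounds: "0 \<le> circle_coord p" "circle_coord p < 1"
  by (transfer; simp add: frac_lt_1)+

lemma to_circle_coord [simp]: "to_circle (circle_coord p) = p"
  by transfer (metis Ints_minus Ints_of_int add_diff_cancel_left' diff_diff_eq2 frac_def minus_diff_eq)

lemma circle_coord_to_circle: "circle_coord (to_circle x) = frac x"
  by (rule circle_coord.abs_eq)

lemma to_circle_eq_iff: "to_circle x = to_circle y \<longleftrightarrow> x - y \<in> \<int>"
  by (rule circle.abs_eq_iff)

lemma infdist_Ints_round: "infdist z \<int> = \<bar>z - of_int (round z)\<bar>" for z :: real
proof (rule antisym)
  show "infdist z \<int> \<le> \<bar>z - of_int (round z)\<bar>"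
    by (metis Ints_of_int dist_real_def infdist_le)
  have "\<bar>z - of_int (round z)\<bar> \<le> (INF n\<in>\<int>. dist z n)"
  proof (rule cINF_greatest)
    show "(\<int>::real set) \<noteq> {}" by (metis Ints_0 empty_iff)
    fix n :: real assume "n \<in> \<int>"
    then show "\<bar>z - of_int (round z)\<bar> \<le> dist z n"
      by (metis Ints_cases dist_real_def round_diff_minimal)
  qed
  moreover have "(\<int>::real set) \<noteq> {}" by (metis Ints_0 empty_iff)
  ultimately show "\<bar>z - of_int (round z)\<bar> \<le> infdist z \<int>"
    by (simp add: infdist_def)
qed

lemma infdist_Ints_shift: "n \<in> \<int> \<Longrightarrow> infdist (z + n) \<int> = infdist z \<int>" for z :: real
proof -
  have le: "infdist (z + n) \<int> \<le> infdist z \<int>" if n: "n \<in> \<int>" for z n :: real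
  proof -
    obtain m where m: "n = of_int m" using n by (rule Ints_cases)
    have "infdist (z + n) \<int> \<le> dist (z + n) (of_int (round z + m))"
      by (rule infdist_le) (rule Ints_of_int)
    then show ?thesis by (simp add: m infdist_Ints_round dist_real_def)
  qed
  show "n \<in> \<int> \<Longrightarrow> infdist (z + n) \<int> = infdist z \<int>"
    using le[of n z] le[of "- n" "z + n"] by simp
qed

instantiation circle :: metric_space
begin

lift_definition dist_circle :: "circle \<Rightarrow> circle \<Rightarrow> real" is "\<lambda>x y. infdist (x - y) \<int>"
proof -
  fix x x' y y' :: real
  assume "x - x' \<in> \<int>" "y - y' \<in> \<int>"
  then have "(x - x') - (y - y') \<in> \<int>" by (rule Ints_diff)
  from infdist_Ints_shift[OF this, of "x' - y'"]
  show "infdist (x - y) \<int> = infdist (x' - y') \<int>" by (simp add: algebra_simps)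
qed

definition uniformity_circle :: "(circle \<times> circle) filter" where
  "uniformity_circle = (INF e\<in>{0<..}. principal {(x, y). dist x y < e})"

definition open_circle :: "circle set \<Rightarrow> bool" where
  "open_circle U = (\<forall>x\<in>U. eventually (\<lambda>(x', y). x' = x \<longrightarrow> y \<in> U) uniformity)"

instance
proof
  show "uniformity = (INF e\<in>{0<..}. principal {(x :: circle, y). dist x y < e})"
    by (rule uniformity_circle_def)
  show "open U = (\<forall>x\<in>U. eventually (\<lambda>(x', y). x' = x \<longrightarrow> y \<in> U) uniformity)" for U :: "circle set"
    by (rule open_circle_def)
  show "dist x y = 0 \<longleftrightarrow> x = y" for x y :: circle
    by transfer (metis Ints_0 closed_Ints empty_iff in_closed_iff_infdist_zero)
  show "dist x y \<le> dist x z + dist y z" for x y z :: circle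
  proof transfer
    fix x y z :: real
    have "infdist (x - y) \<int> \<le> dist (x - y) (of_int (round (x - z) - round (y - z)))"
      by (rule infdist_le) (rule Ints_of_int)
    also have "\<dots> \<le> infdist (x - z) \<int> + infdist (y - z) \<int>"
      by (simp add: infdist_Ints_round dist_real_def)
    finally show "infdist (x - y) \<int> \<le> infdist (x - z) \<int> + infdist (y - z) \<int>" .
  qed
qed

end

lemma dist_to_circle: "dist (to_circle x) (to_circle y) = \<bar>(x - y) - of_int (round (x - y))\<bar>"
  by (simp add: dist_circle.abs_eq infdist_Ints_round)

definition circle_lebesgue :: "circle measure" where
  "circle_lebesgue = distr (restrict_space lborel {0..<1}) borel to_circle"


section \<open>Regularity classes\<close>

text \<open>The \<open>i\<close>-th derivative of a real-valued function on the circle; such a function is a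
  1-periodic function on the line.\<close>

definition fun_deriv :: "nat \<Rightarrow> (circle \<Rightarrow> real) \<Rightarrow> circle \<Rightarrow> real" where
  "fun_deriv i \<phi> p = (deriv ^^ i) (\<phi> \<circ> to_circle) (circle_coord p)"

text \<open>For integer \<open>s\<close> no Hoelder condition is imposed on the last derivative.\<close>

definition C_fun :: "real \<Rightarrow> (circle \<Rightarrow> real) \<Rightarrow> bool" where
  "C_fun s \<phi> \<longleftrightarrow>
     (\<forall>i < nat \<lfloor>s\<rfloor>. \<forall>x. (deriv ^^ i) (\<phi> \<circ> to_circle) field_differentiable at x) \<and>
     continuous_on UNIV ((deriv ^^ nat \<lfloor>s\<rfloor>) (\<phi> \<circ> to_circle)) \<and>
     (s \<notin> \<int> \<longrightarrow> (\<exists>K. \<forall>p q.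
        \<bar>fun_deriv (nat \<lfloor>s\<rfloor>) \<phi> p - fun_deriv (nat \<lfloor>s\<rfloor>) \<phi> q\<bar> \<le> K * dist p q powr frac s))"

definition holder_seminorm :: "real \<Rightarrow> (circle \<Rightarrow> real) \<Rightarrow> real" where
  "holder_seminorm \<alpha> \<phi> = (SUP (p, q)\<in>{(p, q). p \<noteq> q}. \<bar>\<phi> p - \<phi> q\<bar> / dist p q powr \<alpha>)"

definition C_norm :: "real \<Rightarrow> (circle \<Rightarrow> real) \<Rightarrow> real" where
  "C_norm s \<phi> = (\<Sum>i\<le>nat \<lfloor>s\<rfloor>. SUP p. \<bar>fun_deriv i \<phi> p\<bar>) +
     (if s \<in> \<int> then 0 else holder_seminorm (frac s) (fun_deriv (nat \<lfloor>s\<rfloor>) \<phi>))"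

definition is_lift :: "(circle \<Rightarrow> circle) \<Rightarrow> (real \<Rightarrow> real) \<Rightarrow> bool" where
  "is_lift f F \<longleftrightarrow> continuous_on UNIV F \<and> (\<forall>x. to_circle (F x) = f (to_circle x))"

text \<open>Two lifts of the same map differ by an integer constant, so the derivative does not depend
  on the choice of the lift.\<close>

definition map_deriv :: "(circle \<Rightarrow> circle) \<Rightarrow> circle \<Rightarrow> real" where
  "map_deriv f p = deriv (SOME F. is_lift f F) (circle_coord p)"

text \<open>Meant for \<open>r \<ge> 1\<close>.\<close>

definition C_map :: "real \<Rightarrow> (circle \<Rightarrow> circle) \<Rightarrow> bool" where
  "C_map r f \<longleftrightarrow>
     (\<exists>F. is_lift f F \<and> (\<forall>x. F field_differentiable at x)) \<and> C_fun (r - 1) (map_deriv f)"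

definition expanding_maps :: "real \<Rightarrow> (circle \<Rightarrow> circle) set" where
  "expanding_maps r = {f. C_map r f \<and> (\<forall>p. map_deriv f p > 1)}"

text \<open>The distance of the \<open>C\<^sup>r\<close> topology. It is cut off outside the space of expanding maps because
  \<^locale>\<open>Metric_space\<close> asks for nonnegativity everywhere.\<close>

definition C_dist :: "real \<Rightarrow> (circle \<Rightarrow> circle) \<Rightarrow> (circle \<Rightarrow> circle) \<Rightarrow> real" where
  "C_dist r f g =
     (if f \<in> expanding_maps r \<and> g \<in> expanding_maps r
      then (SUP p. dist (f p) (g p)) + C_norm (r - 1) (\<lambda>p. map_deriv f p - map_deriv g p)
      else 0)"

lemma deriv_iter_lincomb:
  fixes g h :: "real \<Rightarrow> real"
  assumes "\<forall>i<n. \<forall>x. (deriv ^^ i) g field_differentiable at x"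
    and "\<forall>i<n. \<forall>x. (deriv ^^ i) h field_differentiable at x"
    and "i \<le> n"
  shows "(deriv ^^ i) (\<lambda>x. a * g x + b * h x) = (\<lambda>x. a * (deriv ^^ i) g x + b * (deriv ^^ i) h x)"
  using \<open>i \<le> n\<close>
proof (induction i)
  case 0
  then show ?case by simp
next
  case (Suc i)
  then have "(deriv ^^ i) g field_differentiable at x" "(deriv ^^ i) h field_differentiable at x" for x
    using assms(1,2) by auto
  then have "deriv (\<lambda>x. a * (deriv ^^ i) g x + b * (deriv ^^ i) h x) x =
      a * deriv ((deriv ^^ i) g) x + b * deriv ((deriv ^^ i) h) x" for x
    by (intro DERIV_imp_deriv derivative_intros DERIV_cmult) (simp_all add: field_differentiable_derivI)
  then show ?case using Suc by auto
qed

lemma fun_deriv_lincomb: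
  assumes "C_fun s \<phi>" "C_fun s \<psi>" "i \<le> nat \<lfloor>s\<rfloor>"
  shows "fun_deriv i (\<lambda>p. a * \<phi> p + b * \<psi> p) p = a * fun_deriv i \<phi> p + b * fun_deriv i \<psi> p"
  using deriv_iter_lincomb[of "nat \<lfloor>s\<rfloor>" "\<phi> \<circ> to_circle" "\<psi> \<circ> to_circle" i a b] assms
  by (simp add: C_fun_def fun_deriv_def o_def)

lemma C_fun_lincomb:
  assumes "C_fun s \<phi>" "C_fun s \<psi>"
  shows "C_fun s (\<lambda>p. a * \<phi> p + b * \<psi> p)"
proof -
  let ?n = "nat \<lfloor>s\<rfloor>"
  have eq: "(deriv ^^ i) ((\<lambda>p. a * \<phi> p + b * \<psi> p) \<circ> to_circle) =
      (\<lambda>x. a * (deriv ^^ i) (\<phi> \<circ> to_circle) x + b * (deriv ^^ i) (\<psi> \<circ> to_circle) x)"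
    if "i \<le> ?n" for i
    using deriv_iter_lincomb[of ?n "\<phi> \<circ> to_circle" "\<psi> \<circ> to_circle" i a b] assms that
    by (simp add: C_fun_def o_def)
  have "(deriv ^^ i) ((\<lambda>p. a * \<phi> p + b * \<psi> p) \<circ> to_circle) field_differentiable at x"
    if "i < ?n" for i x
    using assms that unfolding C_fun_def eq[OF less_imp_le[OF that]]
    by (intro field_differentiable_add field_differentiable_mult field_differentiable_const) auto
  moreover have "continuous_on UNIV ((deriv ^^ ?n) ((\<lambda>p. a * \<phi> p + b * \<psi> p) \<circ> to_circle))"
    using assms unfolding C_fun_def eq[OF order_refl] by (intro continuous_intros) auto
  moreover have "\<exists>K. \<forall>p q. \<bar>fun_deriv ?n (\<lambda>p. a * \<phi> p + b * \<psi> p) p -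
      fun_deriv ?n (\<lambda>p. a * \<phi> p + b * \<psi> p) q\<bar> \<le> K * dist p q powr frac s" if "s \<notin> \<int>"
  proof -
    obtain K L where
      K: "\<And>p q. \<bar>fun_deriv ?n \<phi> p - fun_deriv ?n \<phi> q\<bar> \<le> K * dist p q powr frac s" and
      L: "\<And>p q. \<bar>fun_deriv ?n \<psi> p - fun_deriv ?n \<psi> q\<bar> \<le> L * dist p q powr frac s"
      using assms \<open>s \<notin> \<int>\<close> unfolding C_fun_def by blast
    have "\<bar>fun_deriv ?n (\<lambda>p. a * \<phi> p + b * \<psi> p) p - fun_deriv ?n (\<lambda>p. a * \<phi> p + b * \<psi> p) q\<bar>
        \<le> (\<bar>a\<bar> * K + \<bar>b\<bar> * L) * dist p q powr frac s" for p q
    proof -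
      have "\<bar>fun_deriv ?n (\<lambda>p. a * \<phi> p + b * \<psi> p) p - fun_deriv ?n (\<lambda>p. a * \<phi> p + b * \<psi> p) q\<bar>
          = \<bar>a * (fun_deriv ?n \<phi> p - fun_deriv ?n \<phi> q) + b * (fun_deriv ?n \<psi> p - fun_deriv ?n \<psi> q)\<bar>"
        by (simp add: fun_deriv_lincomb[OF assms order_refl] algebra_simps)
      also have "\<dots> \<le> \<bar>a\<bar> * \<bar>fun_deriv ?n \<phi> p - fun_deriv ?n \<phi> q\<bar> + \<bar>b\<bar> * \<bar>fun_deriv ?n \<psi> p - fun_deriv ?n \<psi> q\<bar>"
        by (rule order_trans[OF abs_triangle_ineq]) (simp add: abs_mult)
      also have "\<dots> \<le> \<bar>a\<bar> * (K * dist p q powr frac s) + \<bar>b\<bar> * (L * dist p q powr frac s)"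
        by (intro add_mono mult_left_mono K L) auto
      finally show ?thesis by (simp add: algebra_simps)
    qed
    then show ?thesis by blast
  qed
  ultimately show ?thesis unfolding C_fun_def by blast
qed

lemma fun_deriv_bdd:
  assumes "C_fun s \<phi>" "i \<le> nat \<lfloor>s\<rfloor>"
  shows "bdd_above (range (\<lambda>p. \<bar>fun_deriv i \<phi> p\<bar>))"
proof -
  have "continuous_on UNIV ((deriv ^^ i) (\<phi> \<circ> to_circle))"
  proof (cases "i = nat \<lfloor>s\<rfloor>")
    case True
    then show ?thesis using assms by (simp add: C_fun_def)
  next
    case False
    then have "\<forall>x. (deriv ^^ i) (\<phi> \<circ> to_circle) field_differentiable at x"
      using assms by (simp add: C_fun_def)
    then show ?thesis
      using continuous_at_imp_continuous_on field_differentiable_imp_continuous_at by blast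
  qed
  then have "compact ((deriv ^^ i) (\<phi> \<circ> to_circle) ` {0..1})"
    by (meson compact_Icc compact_continuous_image continuous_on_subset subset_UNIV)
  then have "bounded ((deriv ^^ i) (\<phi> \<circ> to_circle) ` {0..1})"
    by (rule compact_imp_bounded)
  then obtain B where "\<forall>y \<in> (deriv ^^ i) (\<phi> \<circ> to_circle) ` {0..1}. norm y \<le> B"
    unfolding bounded_iff by (rule exE)
  then have B: "\<bar>(deriv ^^ i) (\<phi> \<circ> to_circle) x\<bar> \<le> B" if "x \<in> {0..1}" for x
    using that by simp
  show ?thesis
  proof (rule bdd_aboveI[of _ B])
    fix y assume "y \<in> range (\<lambda>p. \<bar>fun_deriv i \<phi> p\<bar>)"
    then obtain p where "y = \<bar>fun_deriv i \<phi> p\<bar>" by (rule rangeE)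
    then show "y \<le> B"
      using B[of "circle_coord p"] circle_coord_bounds[of p] by (simp add: fun_deriv_def)
  qed
qed

lemma holder_bdd:
  assumes "C_fun s \<phi>" "s \<notin> \<int>"
  shows "bdd_above ((\<lambda>(p, q). \<bar>fun_deriv (nat \<lfloor>s\<rfloor>) \<phi> p - fun_deriv (nat \<lfloor>s\<rfloor>) \<phi> q\<bar> / dist p q powr frac s)
    ` {(p, q). p \<noteq> q})"
proof -
  obtain K where
    "\<And>p q. \<bar>fun_deriv (nat \<lfloor>s\<rfloor>) \<phi> p - fun_deriv (nat \<lfloor>s\<rfloor>) \<phi> q\<bar> \<le> K * dist p q powr frac s"
    using assms unfolding C_fun_def by blast
  then show ?thesis
    by (intro bdd_aboveI[of _ K]) (auto simp: divide_le_eq)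
qed

lemma circle_distinct_pair: "(to_circle 0, to_circle (1/2)) \<in> {(p, q). p \<noteq> q}"
proof -
  have "dist (to_circle 0) (to_circle (1/2)) = 1/2"
    by (simp add: dist_to_circle round_def)
  then show ?thesis by auto
qed

lemma C_norm_nonneg:
  assumes "C_fun s \<phi>"
  shows "0 \<le> C_norm s \<phi>"
proof -
  have "0 \<le> (SUP p. \<bar>fun_deriv i \<phi> p\<bar>)" if "i \<le> nat \<lfloor>s\<rfloor>" for i
    by (rule cSUP_upper2[OF fun_deriv_bdd[OF assms that], of "to_circle 0"]) auto
  moreover have "0 \<le> holder_seminorm (frac s) (fun_deriv (nat \<lfloor>s\<rfloor>) \<phi>)" if "s \<notin> \<int>"
    unfolding holder_seminorm_def
    by (rule cSUP_upper2[OF holder_bdd[OF assms that] circle_distinct_pair]) auto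
  ultimately show ?thesis
    unfolding C_norm_def by (auto intro!: add_nonneg_nonneg sum_nonneg)
qed

lemma C_norm_add:
  assumes "C_fun s \<phi>" "C_fun s \<psi>"
  shows "C_norm s (\<lambda>p. \<phi> p + \<psi> p) \<le> C_norm s \<phi> + C_norm s \<psi>"
proof -
  have fd: "fun_deriv i (\<lambda>p. \<phi> p + \<psi> p) p = fun_deriv i \<phi> p + fun_deriv i \<psi> p"
    if "i \<le> nat \<lfloor>s\<rfloor>" for i p
    using fun_deriv_lincomb[OF assms that, of 1 1] by simp
  have "(SUP p. \<bar>fun_deriv i (\<lambda>p. \<phi> p + \<psi> p) p\<bar>) \<le>
      (SUP p. \<bar>fun_deriv i \<phi> p\<bar>) + (SUP p. \<bar>fun_deriv i \<psi> p\<bar>)" if "i \<le> nat \<lfloor>s\<rfloor>" for i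
  proof (rule cSUP_least)
    fix p
    have "\<bar>fun_deriv i \<phi> p\<bar> \<le> (SUP p. \<bar>fun_deriv i \<phi> p\<bar>)" "\<bar>fun_deriv i \<psi> p\<bar> \<le> (SUP p. \<bar>fun_deriv i \<psi> p\<bar>)"
      by (intro cSUP_upper fun_deriv_bdd[OF _ that] assms UNIV_I)+
    then show "\<bar>fun_deriv i (\<lambda>p. \<phi> p + \<psi> p) p\<bar> \<le>
        (SUP p. \<bar>fun_deriv i \<phi> p\<bar>) + (SUP p. \<bar>fun_deriv i \<psi> p\<bar>)"
      unfolding fd[OF that] by linarith
  qed simp
  then have 1: "(\<Sum>i\<le>nat \<lfloor>s\<rfloor>. SUP p. \<bar>fun_deriv i (\<lambda>p. \<phi> p + \<psi> p) p\<bar>) \<le>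
      (\<Sum>i\<le>nat \<lfloor>s\<rfloor>. SUP p. \<bar>fun_deriv i \<phi> p\<bar>) + (\<Sum>i\<le>nat \<lfloor>s\<rfloor>. SUP p. \<bar>fun_deriv i \<psi> p\<bar>)"
    unfolding sum.distrib[symmetric] by (intro sum_mono) auto
  have 2: "holder_seminorm (frac s) (fun_deriv (nat \<lfloor>s\<rfloor>) (\<lambda>p. \<phi> p + \<psi> p)) \<le>
      holder_seminorm (frac s) (fun_deriv (nat \<lfloor>s\<rfloor>) \<phi>) + holder_seminorm (frac s) (fun_deriv (nat \<lfloor>s\<rfloor>) \<psi>)"
    if s: "s \<notin> \<int>"
    unfolding holder_seminorm_def
  proof (rule cSUP_least)
    show "{(p, q). p \<noteq> (q :: circle)} \<noteq> {}" using circle_distinct_pair by blast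
    fix z :: "circle \<times> circle" assume z: "z \<in> {(p, q). p \<noteq> q}"
    obtain p q where pq: "z = (p, q)" by (cases z)
    let ?n = "nat \<lfloor>s\<rfloor>" and ?d = "dist p q powr frac s"
    have "\<bar>fun_deriv ?n (\<lambda>p. \<phi> p + \<psi> p) p - fun_deriv ?n (\<lambda>p. \<phi> p + \<psi> p) q\<bar> / ?d \<le>
        (\<bar>fun_deriv ?n \<phi> p - fun_deriv ?n \<phi> q\<bar> + \<bar>fun_deriv ?n \<psi> p - fun_deriv ?n \<psi> q\<bar>) / ?d"
      unfolding fd[OF order_refl] by (intro divide_right_mono) (linarith, simp)
    also have "\<dots> = \<bar>fun_deriv ?n \<phi> p - fun_deriv ?n \<phi> q\<bar> / ?d + \<bar>fun_deriv ?n \<psi> p - fun_deriv ?n \<psi> q\<bar> / ?d"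
      by (rule add_divide_distrib)
    also have "\<dots> \<le> (SUP (p, q)\<in>{(p, q). p \<noteq> q}. \<bar>fun_deriv ?n \<phi> p - fun_deriv ?n \<phi> q\<bar> / dist p q powr frac s) +
        (SUP (p, q)\<in>{(p, q). p \<noteq> q}. \<bar>fun_deriv ?n \<psi> p - fun_deriv ?n \<psi> q\<bar> / dist p q powr frac s)"
      using cSUP_upper[OF z holder_bdd[OF assms(1) s]] cSUP_upper[OF z holder_bdd[OF assms(2) s]]
      by (auto simp: pq intro!: add_mono)
    finally show "(case z of (p, q) \<Rightarrow> \<bar>fun_deriv ?n (\<lambda>p. \<phi> p + \<psi> p) p - fun_deriv ?n (\<lambda>p. \<phi> p + \<psi> p) q\<bar> / dist p q powr frac s)
        \<le> (SUP (p, q)\<in>{(p, q). p \<noteq> q}. \<bar>fun_deriv ?n \<phi> p - fun_deriv ?n \<phi> q\<bar> / dist p q powr frac s) +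
        (SUP (p, q)\<in>{(p, q). p \<noteq> q}. \<bar>fun_deriv ?n \<psi> p - fun_deriv ?n \<psi> q\<bar> / dist p q powr frac s)"
      by (simp add: pq)
  qed
  show ?thesis using 1 2 unfolding C_norm_def by auto
qed

lemma C_norm_minus_commute:
  assumes "C_fun s \<phi>" "C_fun s \<psi>"
  shows "C_norm s (\<lambda>p. \<phi> p - \<psi> p) = C_norm s (\<lambda>p. \<psi> p - \<phi> p)"
proof -
  have fd: "\<bar>fun_deriv i (\<lambda>p. \<phi> p - \<psi> p) p\<bar> = \<bar>fun_deriv i (\<lambda>p. \<psi> p - \<phi> p) p\<bar>" 
     "\<bar>fun_deriv i (\<lambda>p. \<phi> p - \<psi> p) p - fun_deriv i (\<lambda>p. \<phi> p - \<psi> p) q\<bar> =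
      \<bar>fun_deriv i (\<lambda>p. \<psi> p - \<phi> p) p - fun_deriv i (\<lambda>p. \<psi> p - \<phi> p) q\<bar>"
    if "i \<le> nat \<lfloor>s\<rfloor>" for i p q
    using fun_deriv_lincomb[OF assms that, of 1 "-1"] fun_deriv_lincomb[OF assms(2,1) that, of 1 "-1"]
    by auto
  show ?thesis
    unfolding C_norm_def holder_seminorm_def by (simp add: fd)
qed

lemma C_norm_zero: "C_norm s (\<lambda>p. 0) = 0"
proof -
  have "(deriv ^^ i) (\<lambda>x::real. 0::real) = (\<lambda>x. 0)" for i
    by (induction i) auto
  then have fd: "fun_deriv i (\<lambda>p. 0) = (\<lambda>p. 0)" for i
    by (auto simp: fun_deriv_def o_def)
  have "{(p, q). p \<noteq> (q :: circle)} \<noteq> {}" using circle_distinct_pair by blast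
  then show ?thesis
    by (simp add: C_norm_def fd holder_seminorm_def case_prod_beta)
qed

lemma dist_circle_le: "dist p q \<le> 1 / 2" for p q :: circle
proof transfer
  fix x y :: real
  show "infdist (x - y) \<int> \<le> 1 / 2"
    using of_int_round_abs_le[of "x - y"] by (simp add: infdist_Ints_round abs_minus_commute)
qed

lemma Metric_space_C_dist: "Metric_space (expanding_maps r) (C_dist r)"
proof
  have C: "C_fun (r - 1) (map_deriv f)" if "f \<in> expanding_maps r" for f
    using that by (simp add: expanding_maps_def C_map_def)
  have Cd: "C_fun (r - 1) (\<lambda>p. map_deriv f p - map_deriv g p)"
    if "f \<in> expanding_maps r" "g \<in> expanding_maps r" for f g
    using C_fun_lincomb[OF C[OF that(1)] C[OF that(2)], of 1 "-1"] by simp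
  have bdd: "bdd_above (range (\<lambda>p. dist (f p) (g p)))" for f g :: "circle \<Rightarrow> circle"
    using dist_circle_le by (intro bdd_aboveI[of _ "1/2"]) blast
  have sup_ge: "dist (f p) (g p) \<le> (SUP p. dist (f p) (g p))" for f g :: "circle \<Rightarrow> circle" and p
    by (rule cSUP_upper[OF UNIV_I bdd])
  have sup_nonneg: "0 \<le> (SUP p. dist (f p) (g p))" for f g :: "circle \<Rightarrow> circle"
    by (rule order_trans[OF zero_le_dist sup_ge[of f "to_circle 0" g]])
  fix f g h :: "circle \<Rightarrow> circle"
  show "0 \<le> C_dist r f g"
    using sup_nonneg[of f g] C_norm_nonneg[OF Cd] by (auto simp: C_dist_def)
  show "C_dist r f g = C_dist r g f"
    by (auto simp: C_dist_def dist_commute C_norm_minus_commute[OF C C])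
  show "C_dist r f g = 0 \<longleftrightarrow> f = g" if fg: "f \<in> expanding_maps r" "g \<in> expanding_maps r"
  proof
    assume "C_dist r f g = 0"
    then have "(SUP p. dist (f p) (g p)) = 0"
      using sup_nonneg[of f g] C_norm_nonneg[OF Cd[OF fg]] fg by (auto simp: C_dist_def)
    then have "dist (f p) (g p) \<le> 0" for p
      using sup_ge[of f p g] by simp
    then show "f = g" by (simp add: fun_eq_iff)
  qed (use fg in \<open>simp add: C_dist_def C_norm_zero\<close>)
  show "C_dist r f h \<le> C_dist r f g + C_dist r g h"
    if fgh: "f \<in> expanding_maps r" "g \<in> expanding_maps r" "h \<in> expanding_maps r"
  proof -
    have "(SUP p. dist (f p) (h p)) \<le> (SUP p. dist (f p) (g p)) + (SUP p. dist (g p) (h p))"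
    proof (rule cSUP_least)
      fix p
      show "dist (f p) (h p) \<le> (SUP p. dist (f p) (g p)) + (SUP p. dist (g p) (h p))"
        using dist_triangle[of "f p" "h p" "g p"] sup_ge[of f p g] sup_ge[of g p h] by linarith
    qed simp
    moreover have "C_norm (r - 1) (\<lambda>p. map_deriv f p - map_deriv h p) \<le>
        C_norm (r - 1) (\<lambda>p. map_deriv f p - map_deriv g p) +
        C_norm (r - 1) (\<lambda>p. map_deriv g p - map_deriv h p)"
      using C_norm_add[OF Cd[OF fgh(1,2)] Cd[OF fgh(2,3)]] by simp
    ultimately show ?thesis using fgh by (simp add: C_dist_def)
  qed
qed

definition C_topology :: "real \<Rightarrow> (circle \<Rightarrow> circle) topology" where
  "C_topology r = Metric_space.mtopology (expanding_maps r) (C_dist r)"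

lemma topspace_C_topology: "topspace (C_topology r) = expanding_maps r"
  unfolding C_topology_def by (rule Metric_space.topspace_mtopology[OF Metric_space_C_dist])

definition generic :: "'a topology \<Rightarrow> ('a \<Rightarrow> bool) \<Rightarrow> bool" where
  "generic X Q \<longleftrightarrow>
     (\<exists>\<U>. countable \<U> \<and> (\<forall>U\<in>\<U>. openin X U \<and> X closure_of U = topspace X) \<and>
          (\<forall>f \<in> topspace X \<inter> \<Inter>\<U>. Q f))"


section \<open>SRB measure, discretizations, Cramer distance\<close>

definition srb_measure :: "(circle \<Rightarrow> circle) \<Rightarrow> circle measure" where
  "srb_measure f =
     (THE \<mu>. sets \<mu> = sets borel \<and> prob_space \<mu> \<and> distr \<mu> borel f = \<mu> \<and>
             absolutely_continuous circle_lebesgue \<mu>)"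

definition grid :: "nat \<Rightarrow> circle set" where
  "grid N = (\<lambda>i. to_circle (real i / real N)) ` {..<N}"

definition nearest_projection :: "(nat \<Rightarrow> circle \<Rightarrow> circle) \<Rightarrow> bool" where
  "nearest_projection P \<longleftrightarrow>
     (\<forall>N\<ge>1. \<forall>p. P N p \<in> grid N \<and> (\<forall>q\<in>grid N. dist p (P N p) \<le> dist p q))"

text \<open>The pushforward of the uniform measure on \<open>grid N\<close> under the \<open>k\<close>-th iterate of
  \<open>P N \<circ> f\<close>, which maps \<open>grid N\<close> to itself.\<close>

definition discretized_image ::
  "(nat \<Rightarrow> circle \<Rightarrow> circle) \<Rightarrow> (circle \<Rightarrow> circle) \<Rightarrow> nat \<Rightarrow> nat \<Rightarrow> circle measure" where
  "discretized_image P f N k = distr (uniform_count_measure (grid N)) borel ((P N \<circ> f) ^^ k)"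

definition circle_cdf :: "circle measure \<Rightarrow> real \<Rightarrow> real" where
  "circle_cdf \<mu> x = measure \<mu> {p. circle_coord p \<le> x}"

definition cramer_dist :: "circle measure \<Rightarrow> circle measure \<Rightarrow> real" where
  "cramer_dist \<mu> \<nu> =
     sqrt (INF c. LBINT x:{0..1}. (circle_cdf \<mu> x - circle_cdf \<nu> x - c)\<^sup>2)"

end

(*
  For fixed k the iterate f_N^k follows f^k up to O(1/N), so the discretized
  image is close to the image of Lebesgue measure under f^k; it remains to bound the distance of that
  image to the SRB measure by an exponential rate depending only on inf f' and the norm of f'.

  The rate comes from a coupling argument. Densities whose logarithm is Hoelder with a fixed constant A
  are bounded below, and the transfer operator strictly improves A by distortion. So after one step a
  fixed fraction c of the mass can be split off as Lebesgue measure, leaving (1 - c) times a density of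
  the same kind: images of two such densities differ by at most (1 - c)^k on every Borel set after k
  steps. Hence the images of Lebesgue measure converge on every Borel set, and since the
  Hoelder densities span a dense subspace of L^1, the limit is the only absolutely continuous
  invariant probability measure.
*)

theory Submission
  imports Defs
begin

section \<open>Lebesgue measure on the circle\<close>

text \<open>Since \<open>f'\<close> is merely Hoelder, of exponent \<alpha> =
  \<open>min 1 (r - 1)\<close>, densities need not be differentiable, and their regularity is
  measured by a Hoelder constant of the logarithm. An inverse branch turns such a constant
  \<open>A\<close> into \<open>(A + b) * \<theta>\<close>, where \<open>a = inf f'\<close>,
  \<open>\<theta> = a powr (- \<alpha>)\<close> and \<open>b\<close> is the norm of
  \<open>f'\<close>. All later constants are computed from \<open>a\<close>, \<open>b\<close> and
  \<alpha> alone, which is where the uniformity of \<open>C\<close> comes from. The coupling bound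
  is uniform over Borel sets, hence over the arcs that define distribution functions, and a supremum
  bound on their difference controls the Cramer distance. The condition
  \<open>k \<ge> - C * ln \<epsilon>\<close> has no additive constant, so for \<epsilon> near 1 it
  admits values of \<open>k\<close> at which little has decayed. There the free constant in the
  Cramer distance helps: centring the difference of distribution functions bounds the distance of
  any two probability measures by 1/2. Only \<epsilon> below 1/2 is left to the exponential
  rate.\<close>

lemma dist_to_circle_le: "dist (to_circle x) (to_circle y) \<le> \<bar>x - y\<bar>"
  using round_diff_minimal[of "x - y" 0] by (simp add: dist_to_circle)

lemma to_circle_add_int [simp]: "to_circle (x + of_int n) = to_circle x"
  by (simp add: to_circle_eq_iff)

lemma to_circle_add_nat [simp]: "to_circle (x + real n) = to_circle x"
  using to_circle_add_int[of x "int n"] by simp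

text \<open>Shifting one representative by the nearest integer realizes the circle distance on the
  line. Lipschitz and Hoelder bounds proved for lifts descend to the circle this way.\<close>

lemma circle_reps:
  obtains x y where "p = to_circle x" "q = to_circle y" "dist p q = \<bar>x - y\<bar>"
proof -
  let ?x = "circle_coord p" and ?y = "circle_coord q"
  let ?n = "round (?x - ?y)"
  have "dist p q = \<bar>?x - (?y + of_int ?n)\<bar>"
    using dist_to_circle[of ?x ?y] by (simp add: algebra_simps)
  then show thesis
    by (intro that[of ?x "?y + of_int ?n"]) auto
qed

lemma continuous_to_circle: "continuous_on S to_circle"
  unfolding continuous_on_iff using dist_to_circle_le
  by (metis dist_real_def order_le_less_trans)

lemma continuous_on_circleI:
  fixes g :: "circle \<Rightarrow> 'a::metric_space"
  assumes "continuous_on UNIV (g \<circ> to_circle)"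
  shows "continuous_on UNIV g"
  unfolding continuous_on_iff
proof safe
  fix p :: circle and e :: real assume "e > 0"
  let ?x = "circle_coord p"
  obtain \<delta> where \<delta>: "\<delta> > 0" "\<And>y. dist y ?x < \<delta> \<Longrightarrow> dist (g (to_circle y)) (g (to_circle ?x)) < e"
    using assms \<open>e > 0\<close> unfolding continuous_on_iff o_def by (metis UNIV_I)
  have "dist (g q) (g p) < e" if "dist q p < \<delta>" for q
  proof -
    let ?y = "circle_coord q"
    let ?z = "?y - of_int (round (?y - ?x))"
    have "dist ?z ?x < \<delta>"
      using that dist_to_circle[of ?y ?x] by (simp add: dist_real_def algebra_simps)
    moreover have "to_circle ?z = q"
      using to_circle_add_int[of ?y "- round (?y - ?x)"] by simp
    ultimately show ?thesis using \<delta>(2)[of ?z] by simp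
  qed
  then show "\<exists>d>0. \<forall>x'\<in>UNIV. dist x' p < d \<longrightarrow> dist (g x') (g p) < e"
    using \<delta>(1) by blast
qed

lemma to_circle_measurable [measurable]: "to_circle \<in> borel_measurable borel"
  by (rule borel_measurable_continuous_onI[OF continuous_to_circle])

text \<open>\<open>circle_coord\<close> jumps at the point 0, but its nontrivial sublevel sets are
  images of the compact intervals \<open>{0..t}\<close>. This is what makes the coordinate
  Borel.\<close>

lemma closed_coord_le: "closed {p. circle_coord p \<le> t}"
proof (cases "0 \<le> t \<and> t < 1")
  case True
  have "{p. circle_coord p \<le> t} = to_circle ` {0..t}"
  proof safe
    fix p assume "circle_coord p \<le> t"
    then show "p \<in> to_circle ` {0..t}"
      using circle_coord_bounds[of p] by (intro image_eqI[of _ _ "circle_coord p"]) auto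
  qed (use True in \<open>auto simp: circle_coord_to_circle frac_eq_id\<close>)
  then show ?thesis
    using compact_continuous_image[OF continuous_to_circle compact_Icc]
    by (metis compact_imp_closed)
next
  case False
  have "\<not> circle_coord p \<le> t" if "t < 0" for p
    using circle_coord_bounds[of p] that by linarith
  moreover have "circle_coord p \<le> t" if "1 \<le> t" for p
    using circle_coord_bounds[of p] that by linarith
  ultimately have "{p. circle_coord p \<le> t} = {} \<or> {p. circle_coord p \<le> t} = UNIV"
    using False by (cases "t < 0") auto
  then show ?thesis by auto
qed

lemma circle_coord_measurable [measurable]: "circle_coord \<in> borel_measurable borel"
  by (rule borel_measurableI_le) (simp add: borel_closed[OF closed_coord_le])

lemma sets_circle_lebesgue [simp, measurable_cong]: "sets circle_lebesgue = sets borel"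
  by (simp add: circle_lebesgue_def)

lemma space_circle_lebesgue [simp]: "space circle_lebesgue = UNIV"
  by (simp add: circle_lebesgue_def)

lemma nn_integral_circle_lebesgue:
  assumes [measurable]: "u \<in> borel_measurable borel"
  shows "(\<integral>\<^sup>+p. u p \<partial>circle_lebesgue) = (\<integral>\<^sup>+x. u (to_circle x) * indicator {0..<1} x \<partial>lborel)"
proof -
  have "(\<integral>\<^sup>+p. u p \<partial>circle_lebesgue) = (\<integral>\<^sup>+x. u (to_circle x) \<partial>restrict_space lborel {0..<1})"
    unfolding circle_lebesgue_def
    by (subst nn_integral_distr) (auto intro: measurable_restrict_space1)
  also have "\<dots> = (\<integral>\<^sup>+x. u (to_circle x) * indicator {0..<1} x \<partial>lborel)"
    by (subst nn_integral_restrict_space) auto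
  finally show ?thesis .
qed

lemma emeasure_circle_lebesgue:
  assumes [measurable]: "B \<in> sets borel"
  shows "emeasure circle_lebesgue B = emeasure lborel {x\<in>{0..<1}. to_circle x \<in> B}"
proof -
  have "emeasure circle_lebesgue B = (\<integral>\<^sup>+p. indicator B p \<partial>circle_lebesgue)"
    by simp
  also have "\<dots> = (\<integral>\<^sup>+x. indicator {x\<in>{0..<1}. to_circle x \<in> B} x \<partial>lborel)"
    unfolding nn_integral_circle_lebesgue[OF borel_measurable_indicator[OF assms]]
    by (intro nn_integral_cong) (auto split: split_indicator)
  also have "\<dots> = emeasure lborel {x\<in>{0..<1}. to_circle x \<in> B}"
    by (rule nn_integral_indicator) measurable
  finally show ?thesis .
qed

interpretation circle_lebesgue: prob_space circle_lebesgue
proof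
  have "{x. 0 \<le> x \<and> x < 1} = {0..<1::real}" by auto
  then show "emeasure circle_lebesgue (space circle_lebesgue) = 1"
    by (simp add: emeasure_circle_lebesgue)
qed

lemma emeasure_circle_lebesgue_coord:
  assumes [measurable]: "A \<in> sets borel"
  shows "emeasure circle_lebesgue (circle_coord -` A) = emeasure lborel (A \<inter> {0..<1})"
proof -
  have "circle_coord -` A \<in> sets borel"
    using measurable_sets[OF circle_coord_measurable, of A] by simp
  then have "emeasure circle_lebesgue (circle_coord -` A) =
      emeasure lborel {x\<in>{0..<1}. to_circle x \<in> circle_coord -` A}"
    by (rule emeasure_circle_lebesgue)
  also have "{x\<in>{0..<1}. to_circle x \<in> circle_coord -` A} = A \<inter> {0..<1}"
    by (auto simp: circle_coord_to_circle frac_eq_id)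
  finally show ?thesis .
qed

section \<open>Periodic functions on the line\<close>

lemma periodic_add_int:
  fixes u :: "real \<Rightarrow> 'a"
  assumes per: "\<And>x. u (x + 1) = u x"
  shows "u (x + of_int n) = u x"
proof -
  have per_nat: "u (x + real n) = u x" for x n
  proof (induction n)
    case (Suc n)
    then show ?case using per[of "x + real n"] by (simp add: ac_simps)
  qed simp
  show ?thesis
  proof (cases "n \<ge> 0")
    case True
    then show ?thesis using per_nat[of x "nat n"] by simp
  next
    case False
    then show ?thesis using per_nat[of "x + of_int n" "nat (- n)"] by simp
  qed
qed

lemma periodic_frac:
  fixes u :: "real \<Rightarrow> 'a"
  assumes "\<And>x. u (x + 1) = u x"
  shows "u (frac x) = u x"
  using periodic_add_int[of u x "- \<lfloor>x\<rfloor>", OF assms] by (simp add: frac_def)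

text \<open>After an integer translation the period starts at \<open>t = frac a\<close>; the piece
  beyond 1 is moved back by one period and fills \<open>{0..<t}\<close>.\<close>

lemma nn_integral_period_shift:
  fixes u :: "real \<Rightarrow> ennreal"
  assumes [measurable]: "u \<in> borel_measurable borel" and per: "\<And>x. u (x + 1) = u x"
  shows "(\<integral>\<^sup>+x. u x * indicator {a..<a+1} x \<partial>lborel) = (\<integral>\<^sup>+x. u x * indicator {0..<1} x \<partial>lborel)"
proof -
  note per_int = periodic_add_int[of u, OF per]
  define t where "t = frac a"
  have t: "0 \<le> t" "t < 1" by (auto simp: t_def frac_lt_1)
  have shift: "(\<integral>\<^sup>+x. u x * indicator {b..<c} x \<partial>lborel) =
      (\<integral>\<^sup>+x. u x * indicator {b - of_int n..<c - of_int n} x \<partial>lborel)" for b c n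
    by (subst nn_integral_real_affine[where c = 1 and t = "of_int n"])
       (auto intro!: nn_integral_cong simp: per_int add.commute[of "of_int n"] split: split_indicator)
  have split: "(\<integral>\<^sup>+x. u x * indicator {b..<d} x \<partial>lborel) =
      (\<integral>\<^sup>+x. u x * indicator {b..<c} x \<partial>lborel) + (\<integral>\<^sup>+x. u x * indicator {c..<d} x \<partial>lborel)"
    if "b \<le> c" "c \<le> d" for b c d
    using that by (subst nn_integral_add[symmetric]) (auto intro!: nn_integral_cong split: split_indicator)
  have "(\<integral>\<^sup>+x. u x * indicator {a..<a+1} x \<partial>lborel) = (\<integral>\<^sup>+x. u x * indicator {t..<t+1} x \<partial>lborel)"
    using shift[of a "a + 1" "\<lfloor>a\<rfloor>"] by (simp add: t_def frac_def algebra_simps)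
  also have "\<dots> = (\<integral>\<^sup>+x. u x * indicator {t..<1} x \<partial>lborel) + (\<integral>\<^sup>+x. u x * indicator {1..<t+1} x \<partial>lborel)"
    using t by (intro split) auto
  also have "(\<integral>\<^sup>+x. u x * indicator {1..<t+1} x \<partial>lborel) = (\<integral>\<^sup>+x. u x * indicator {0..<t} x \<partial>lborel)"
    using shift[of 1 "t + 1" 1] by simp
  also have "(\<integral>\<^sup>+x. u x * indicator {t..<1} x \<partial>lborel) + \<dots> = (\<integral>\<^sup>+x. u x * indicator {0..<1} x \<partial>lborel)"
    using t by (subst split[of 0 t 1]) (auto simp: add.commute)
  finally show ?thesis .
qed

section \<open>Lifts and transfer operators\<close>

text \<open>One constant \<open>b\<close> bounds both \<open>F'\<close> and its Hoelder quotient,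
  because the norm of \<open>f'\<close> dominates both. The degree \<open>d\<close> is a natural
  number since \<open>F\<close> is increasing.\<close>

locale expanding_lift =
  fixes f :: "circle \<Rightarrow> circle" and F F' :: "real \<Rightarrow> real" and d :: nat and a b \<alpha> :: real
  assumes lift: "to_circle (F x) = f (to_circle x)"
    and F_deriv: "(F has_real_derivative F' x) (at x)"
    and a_gt_1: "1 < a" and F'_ge: "a \<le> F' x" and F'_le: "F' x \<le> b"
    and F'_holder: "\<bar>F' x - F' y\<bar> \<le> b * \<bar>x - y\<bar> powr \<alpha>"
    and \<alpha>_pos: "0 < \<alpha>" and \<alpha>_le_1: "\<alpha> \<le> 1"
    and F_add_1: "F (x + 1) = F x + real d"
begin

lemma F'_pos: "0 < F' x"
  using a_gt_1 F'_ge[of x] by linarith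

lemma b_gt_1: "1 < b"
  using a_gt_1 F'_ge[of 0] F'_le[of 0] by linarith

lemma F_increment:
  assumes "x \<le> y"
  shows "a * (y - x) \<le> F y - F x" "F y - F x \<le> b * (y - x)"
proof -
  have "\<exists>z. F y - F x = (y - x) * F' z"
  proof (cases "x = y")
    case False
    then show ?thesis using MVT2[of x y F F'] F_deriv assms by force
  qed simp
  then obtain z where "F y - F x = (y - x) * F' z" ..
  then show "a * (y - x) \<le> F y - F x" "F y - F x \<le> b * (y - x)"
    using mult_left_mono[OF F'_ge[of z], of "y - x"] mult_left_mono[OF F'_le[of z], of "y - x"] assms
    by (simp_all add: mult.commute)
qed

lemma F_lipschitz: "\<bar>F x - F y\<bar> \<le> b * \<bar>x - y\<bar>"
proof (induction x y rule: linorder_wlog)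
  case (le x y)
  have "0 \<le> a * (y - x)" using le a_gt_1 by simp
  then show ?case using F_increment[OF le] le by simp
qed (simp add: abs_minus_commute)

lemma F_expand: "a * \<bar>x - y\<bar> \<le> \<bar>F x - F y\<bar>"
proof (induction x y rule: linorder_wlog)
  case (le x y)
  then show ?case using F_increment(1)[OF le] by simp
qed (simp add: abs_minus_commute)

lemma continuous_F: "continuous_on S F"
  by (meson F_deriv DERIV_isCont continuous_at_imp_continuous_on)

lemma dist_map_le: "dist (f p) (f q) \<le> b * dist p q"
proof -
  obtain x y where xy: "p = to_circle x" "q = to_circle y" "dist p q = \<bar>x - y\<bar>"
    by (rule circle_reps)
  then show ?thesis
    using order_trans[OF dist_to_circle_le F_lipschitz[of x y]] by (simp add: lift)
qed

lemma map_measurable [measurable]: "f \<in> borel_measurable borel"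
proof (rule borel_measurable_continuous_onI[OF continuous_on_circleI])
  have eq: "f \<circ> to_circle = to_circle \<circ> F" by (auto simp: lift)
  show "continuous_on UNIV (f \<circ> to_circle)"
    unfolding eq by (rule continuous_on_compose[OF continuous_F continuous_to_circle])
qed

lemma F'_add_1: "F' (x + 1) = F' x"
proof -
  have "((\<lambda>x. F (x + 1)) has_real_derivative F' (x + 1)) (at x)"
    using F_deriv[of "x + 1"] by (simp add: DERIV_shift)
  moreover have "((\<lambda>x. F (x + 1)) has_real_derivative F' x) (at x)"
    unfolding F_add_1 by (auto intro!: derivative_eq_intros F_deriv)
  ultimately show ?thesis by (rule DERIV_unique)
qed

lemma d_pos: "0 < d"
  using F_increment(1)[of 0 1] F_add_1[of 0] a_gt_1 by (cases d) auto

lemma inj_F: "inj F"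
proof (rule injI)
  fix x y assume "F x = F y"
  then show "x = y" using F_expand[of x y] a_gt_1 by (simp add: mult_le_0_iff)
qed

lemma surj_F: "surj F"
proof (rule surjI)
  fix y
  \<comment> \<open>Growth at rate at least \<open>a > 1\<close> moves \<open>F\<close> by at least
    \<open>t\<close> over a length \<open>t\<close>, so \<open>y\<close> lies between
    \<open>F (- t)\<close> and \<open>F t\<close>.\<close>
  define t where "t = \<bar>y - F 0\<bar>"
  have t: "t \<le> a * t" using a_gt_1 by (simp add: t_def mult_le_cancel_right1)
  have "0 \<le> t" "- t \<le> y - F 0" "y - F 0 \<le> t" by (auto simp: t_def)
  then have "F (- t) \<le> y" "y \<le> F t"
    using F_increment(1)[of 0 t] F_increment(1)[of "-t" 0] t by auto
  then have "\<exists>x\<ge>-t. x \<le> t \<and> F x = y"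
    by (intro IVT') (auto simp: continuous_F t_def)
  then show "F (SOME x. F x = y) = y" by (metis (mono_tags) someI)
qed

section \<open>The global inverse of the lift and the transfer operator\<close>

definition G :: "real \<Rightarrow> real" where "G = inv F"

lemma F_G [simp]: "F (G y) = y"
  by (simp add: G_def surj_F surj_f_inv_f)

lemma G_F [simp]: "G (F x) = x"
  by (simp add: G_def inj_F)

lemma G_contract: "\<bar>G x - G y\<bar> \<le> \<bar>x - y\<bar> / a"
  using F_expand[of "G x" "G y"] a_gt_1 by (simp add: field_simps)

lemma continuous_G: "continuous_on S G"
proof (rule continuous_on_subset[OF _ subset_UNIV])
  have "dist (G x) (G y) \<le> dist x y" for x y
  proof -
    have "\<bar>x - y\<bar> / a \<le> \<bar>x - y\<bar>" using a_gt_1 by (simp add: divide_le_eq mult_le_cancel_left1)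
    then show ?thesis using G_contract[of x y] by (simp add: dist_real_def)
  qed
  then show "continuous_on UNIV G"
    unfolding continuous_on_iff by (meson order_le_less_trans)
qed

lemma G_add_degree: "G (y + real d) = G y + 1"
  using G_F[of "G y + 1"] by (simp add: F_add_1)

lemma continuous_F': "continuous_on S F'"
proof (rule continuous_on_subset[OF _ subset_UNIV])
  have "((\<lambda>x. \<bar>x - y\<bar>) \<longlongrightarrow> 0) (at y)" for y :: real
    by (rule tendsto_rabs_zero, rule LIM_zero, rule tendsto_ident_at)
  from tendsto_powr2[OF this tendsto_const _ \<alpha>_pos]
  have "((\<lambda>x. \<bar>x - y\<bar> powr \<alpha>) \<longlongrightarrow> 0) (at y)" for y :: real
    by simp
  then have lim: "((\<lambda>x. b * \<bar>x - y\<bar> powr \<alpha>) \<longlongrightarrow> 0) (at y)" for y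
    by (rule tendsto_mult_right_zero)
  have "((\<lambda>x. F' x - F' y) \<longlongrightarrow> 0) (at y)" for y
  proof (rule Lim_null_comparison[OF _ lim])
    show "\<forall>\<^sub>F x in at y. norm (F' x - F' y) \<le> b * \<bar>x - y\<bar> powr \<alpha>"
      by (rule always_eventually) (simp add: F'_holder)
  qed
  then show "continuous_on UNIV F'"
    by (simp add: continuous_on_def LIM_zero_iff)
qed

lemma G_measurable [measurable]: "G \<in> borel_measurable borel"
  by (rule borel_measurable_continuous_onI[OF continuous_G])

lemma F'_measurable [measurable]: "F' \<in> borel_measurable borel"
  by (rule borel_measurable_continuous_onI[OF continuous_F'])

text \<open>The inverse branches of \<open>f\<close> are the maps sending \<open>y\<close> to
  \<open>G (y + j)\<close> for \<open>j < d\<close>, all read off from the single inverse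
  \<open>G\<close>, so the circle need not be partitioned.\<close>

definition branch :: "(circle \<Rightarrow> real) \<Rightarrow> real \<Rightarrow> real" where
  "branch h y = h (to_circle (G y)) / F' (G y)"

definition transfer :: "(circle \<Rightarrow> real) \<Rightarrow> circle \<Rightarrow> real" where
  "transfer h p = (\<Sum>j<d. branch h (circle_coord p + real j))"

text \<open>\<open>branch h\<close> has period \<open>d\<close>, so translating by 1 trades the term
  \<open>j = 0\<close> for an equal term \<open>j = d\<close>; the sum therefore has period 1 and
  any representative may be used.\<close>

lemma transfer_to_circle: "transfer h (to_circle x) = (\<Sum>j<d. branch h (x + real j))"
proof -
  define S where "S x = (\<Sum>j<d. branch h (x + real j))" for x
  have "branch h (x + real d) = branch h x" for x
    using to_circle_add_nat[of "G x" 1] by (simp add: branch_def G_add_degree F'_add_1)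
  then have "S (x + 1) = S x" for x
    using sum.lessThan_Suc_shift[of "\<lambda>j. branch h (x + real j)" d]
      sum.lessThan_Suc[of "\<lambda>j. branch h (x + real j)" d]
    by (simp add: S_def ac_simps)
  then have "S (frac x) = S x" by (rule periodic_frac)
  then show ?thesis
    by (simp add: S_def transfer_def circle_coord_to_circle)
qed

lemma transfer_nonneg: "(\<And>p. 0 \<le> h p) \<Longrightarrow> 0 \<le> transfer h p"
  unfolding transfer_def branch_def by (intro sum_nonneg divide_nonneg_pos F'_pos) auto

lemma branch_measurable [measurable]:
  assumes [measurable]: "h \<in> borel_measurable borel"
  shows "branch h \<in> borel_measurable borel"
  unfolding branch_def by measurable

lemma transfer_measurable [measurable]:
  assumes [measurable]: "h \<in> borel_measurable borel"
  shows "transfer h \<in> borel_measurable borel"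
  unfolding transfer_def by measurable

text \<open>Duality between composition with \<open>f\<close> and the transfer operator: substitute
  \<open>y = F x\<close> over one period, which is stretched onto \<open>d\<close> unit intervals,
  and fold these back onto one.\<close>

lemma nn_integral_transfer:
  assumes [measurable]: "u \<in> borel_measurable borel" "h \<in> borel_measurable borel"
    and h: "\<And>p. 0 \<le> h p"
  shows "(\<integral>\<^sup>+p. u (f p) * ennreal (h p) \<partial>circle_lebesgue) =
    (\<integral>\<^sup>+p. u p * ennreal (transfer h p) \<partial>circle_lebesgue)"
proof -
  define w where "w x = u (f (to_circle x)) * ennreal (h (to_circle x))" for x
  define v where "v y = u (to_circle y) * ennreal (branch h y)" for y
  have [measurable]: "w \<in> borel_measurable borel" "v \<in> borel_measurable borel"
    unfolding w_def v_def by measurable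
  have branch_nonneg: "0 \<le> branch h y" for y
    by (simp add: branch_def h less_imp_le[OF F'_pos])
  have vF: "v (F x) * ennreal (F' x) = w x" for x
  proof -
    have "branch h (F x) * F' x = h (to_circle x)"
      using F'_pos[of x] by (simp add: branch_def)
    then show ?thesis
      using branch_nonneg[of "F x"]
      by (simp add: v_def w_def lift mult.assoc ennreal_mult'[symmetric])
  qed
  have w_per: "w (x + 1) = w x" for x
    using to_circle_add_nat[of x 1] by (simp add: w_def)
  have ae: "AE x in lborel. indicator {s..<t} x = (indicator {s..t} x :: ennreal)" for s t :: real
    using AE_lborel_singleton[of t] by eventually_elim (auto split: split_indicator)
  have "(\<integral>\<^sup>+p. u (f p) * ennreal (h p) \<partial>circle_lebesgue) = (\<integral>\<^sup>+x. w x * indicator {0..<1} x \<partial>lborel)"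
    by (subst nn_integral_circle_lebesgue) (auto simp: w_def)
  \<comment> \<open>Starting the period at \<open>G 0\<close> makes its image under \<open>F\<close>
    the interval from 0 to \<open>d\<close>. The substitution rule is for closed intervals, hence
    the passages between closed and half-open intervals up to null sets.\<close>
  also have "\<dots> = (\<integral>\<^sup>+x. w x * indicator {G 0..<G 0 + 1} x \<partial>lborel)"
    by (rule nn_integral_period_shift[symmetric]) (auto simp: w_per)
  also have "\<dots> = (\<integral>\<^sup>+x. v (F x) * ennreal (F' x) * indicator {G 0..G 0 + 1} x \<partial>lborel)"
    unfolding vF by (rule nn_integral_cong_AE) (use ae[of "G 0" "G 0 + 1"] in eventually_elim, simp)
  also have "\<dots> = (\<integral>\<^sup>+y. v y * indicator {F (G 0)..F (G 0 + 1)} y \<partial>lborel)"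
    by (rule nn_integral_substitution_aux[symmetric])
       (auto intro!: F_deriv continuous_F' less_imp_le[OF F'_pos])
  also have "\<dots> = (\<integral>\<^sup>+y. v y * indicator {0..<real d} y \<partial>lborel)"
    unfolding F_add_1 F_G by (rule nn_integral_cong_AE) (use ae[of 0 "real d"] in eventually_elim, simp)
  also have "\<dots> = (\<Sum>j<d. \<integral>\<^sup>+y. v y * indicator {real j..<real j + 1} y \<partial>lborel)"
  proof -
    have "v y * indicator {0..<real n} y = (\<Sum>j<n. v y * indicator {real j..<real j + 1} y)" for y n
      by (induction n) (auto split: split_indicator)
    then show ?thesis by (simp only:) (rule nn_integral_sum; measurable)
  qed
  also have "\<dots> = (\<Sum>j<d. \<integral>\<^sup>+y. v (real j + y) * indicator {0..<1} y \<partial>lborel)"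
  proof (rule sum.cong[OF refl])
    fix j
    show "(\<integral>\<^sup>+y. v y * indicator {real j..<real j + 1} y \<partial>lborel) =
        (\<integral>\<^sup>+y. v (real j + y) * indicator {0..<1} y \<partial>lborel)"
      by (subst nn_integral_real_affine[where c = 1 and t = "real j"])
         (auto intro!: nn_integral_cong split: split_indicator)
  qed
  also have "\<dots> = (\<integral>\<^sup>+y. u (to_circle y) * ennreal (transfer h (to_circle y)) * indicator {0..<1} y \<partial>lborel)"
  proof -
    have "u (to_circle y) * ennreal (transfer h (to_circle y)) * indicator {0..<1} y =
        (\<Sum>j<d. v (real j + y) * indicator {0..<1} y)" for y
    proof -
      have "ennreal (transfer h (to_circle y)) = (\<Sum>j<d. ennreal (branch h (y + real j)))"
        unfolding transfer_to_circle by (rule sum_ennreal[symmetric]) (rule branch_nonneg)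
      moreover have "v (real j + y) = u (to_circle y) * ennreal (branch h (y + real j))" for j
        using to_circle_add_nat[of y j] by (simp add: v_def add.commute)
      ultimately show ?thesis
        by (simp add: sum_distrib_left sum_distrib_right)
    qed
    then show ?thesis by (simp only:) (rule nn_integral_sum[symmetric]; measurable)
  qed
  also have "\<dots> = (\<integral>\<^sup>+p. u p * ennreal (transfer h p) \<partial>circle_lebesgue)"
    by (rule nn_integral_circle_lebesgue[symmetric]) measurable
  finally show ?thesis .
qed

end

section \<open>Coupling of Hoelder densities\<close>

text \<open>A real integral instead of a measure, so that it is linear in \<open>h\<close> also for
  functions that change sign, such as differences of densities.\<close>

definition mass :: "(circle \<Rightarrow> real) \<Rightarrow> circle set \<Rightarrow> real" where
  "mass h B = (LINT p|circle_lebesgue. indicator B p * h p)"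

text \<open>The middle condition says that \<open>ln h\<close> is \<alpha>-Hoelder with constant
  \<open>A\<close>. It is imposed on all pairs of representatives, so it can be pulled through
  \<open>G\<close> on the line.\<close>

definition holder_density :: "real \<Rightarrow> real \<Rightarrow> (circle \<Rightarrow> real) \<Rightarrow> bool" where
  "holder_density \<alpha> A h \<longleftrightarrow> h \<in> borel_measurable borel \<and> (\<forall>p. 0 < h p) \<and>
     (\<forall>x y. h (to_circle x) \<le> h (to_circle y) * exp (A * \<bar>x - y\<bar> powr \<alpha>)) \<and>
     (LINT p|circle_lebesgue. h p) = 1"

lemma holder_densityD:
  assumes "holder_density \<alpha> A h"
  shows "h \<in> borel_measurable borel" "0 < h p" "(LINT p|circle_lebesgue. h p) = 1"
    "h (to_circle x) \<le> h (to_circle y) * exp (A * \<bar>x - y\<bar> powr \<alpha>)"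
    "integrable circle_lebesgue h"
  \<comment> \<open>The integral of a non-integrable function is 0 by convention, so an integral
    equal to 1 forces integrability.\<close>
  using assms not_integrable_integral_eq[of circle_lebesgue h]
  by (auto simp: holder_density_def)

lemma integrable_indicator_times:
  fixes h :: "circle \<Rightarrow> real"
  assumes "integrable circle_lebesgue h" "B \<in> sets borel"
  shows "integrable circle_lebesgue (\<lambda>p. indicator B p * h p)"
  using integrable_mult_indicator[of B circle_lebesgue h] assms by simp

lemma mass_add:
  assumes "integrable circle_lebesgue g" "integrable circle_lebesgue h" "B \<in> sets borel"
  shows "mass (\<lambda>p. g p + h p) B = mass g B + mass h B"
  by (simp add: mass_def distrib_left integrable_indicator_times assms)

lemma mass_cmult: "mass (\<lambda>p. t * h p) B = t * mass h B"
  by (simp add: mass_def mult.left_commute)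

lemma mass_const: "B \<in> sets borel \<Longrightarrow> mass (\<lambda>p. t) B = t * measure circle_lebesgue B"
  by (simp add: mass_def)

lemma mass_mono:
  assumes "integrable circle_lebesgue g" "integrable circle_lebesgue h" "B \<in> sets borel"
    and "\<And>p. g p \<le> h p"
  shows "mass g B \<le> mass h B"
  unfolding mass_def
  by (intro integral_mono integrable_indicator_times mult_left_mono) (auto simp: assms)

lemma mass_abs_le:
  assumes "integrable circle_lebesgue h" "B \<in> sets borel"
  shows "\<bar>mass h B\<bar> \<le> (LINT p|circle_lebesgue. \<bar>h p\<bar>)"
proof -
  have "\<bar>mass h B\<bar> \<le> (LINT p|circle_lebesgue. \<bar>indicator B p * h p\<bar>)"
    unfolding mass_def by (rule integral_abs_bound)
  also have "\<dots> \<le> (LINT p|circle_lebesgue. \<bar>h p\<bar>)"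
    by (intro integral_mono integrable_abs integrable_indicator_times assms)
       (auto split: split_indicator)
  finally show ?thesis .
qed

lemma mass_diff:
  assumes "integrable circle_lebesgue g" "integrable circle_lebesgue h" "B \<in> sets borel"
  shows "mass (\<lambda>p. g p - h p) B = mass g B - mass h B"
  by (simp add: mass_def right_diff_distrib integrable_indicator_times assms)

lemma mass_holder_density:
  assumes h: "holder_density \<alpha> A h" and B: "B \<in> sets borel"
  shows "0 \<le> mass h B" "mass h B \<le> 1"
proof -
  show "0 \<le> mass h B"
    unfolding mass_def using less_imp_le[OF holder_densityD(2)[OF h]] by (intro integral_nonneg_AE) simp
  have "\<bar>mass h B\<bar> \<le> (LINT p|circle_lebesgue. \<bar>h p\<bar>)"
    by (rule mass_abs_le[OF holder_densityD(5)[OF h] B])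
  also have "\<dots> = 1"
    using less_imp_le[OF holder_densityD(2)[OF h]] holder_densityD(3)[OF h] by simp
  finally show "mass h B \<le> 1" by simp
qed

lemma holder_density_mono:
  assumes "holder_density \<alpha> A h" "A \<le> A'"
  shows "holder_density \<alpha> A' h"
proof -
  have "h (to_circle x) \<le> h (to_circle y) * exp (A' * \<bar>x - y\<bar> powr \<alpha>)" for x y
    using holder_densityD(2,4)[OF assms(1)] assms(2)
    by (meson exp_le_cancel_iff less_imp_le mult_left_mono mult_right_mono order_trans powr_ge_zero)
  then show ?thesis using assms(1) by (simp add: holder_density_def)
qed

lemma holder_density_const: "0 \<le> A \<Longrightarrow> holder_density \<alpha> A (\<lambda>p. 1)"
  using circle_lebesgue.prob_space by (simp add: holder_density_def)

text \<open>Circle distances are below 1, so any two values of \<open>h\<close> have ratio at most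
  \<open>exp A\<close>; averaging either one against total mass 1 gives both bounds.\<close>

lemma holder_density_bounds:
  assumes h: "holder_density \<alpha> A h" and "0 \<le> A" "0 \<le> \<alpha>"
  shows "exp (- A) \<le> h p" "h p \<le> exp A"
proof -
  have le: "h p \<le> h q * exp A" for p q
  proof -
    obtain x y where xy: "p = to_circle x" "q = to_circle y" "dist p q = \<bar>x - y\<bar>"
      by (rule circle_reps)
    have "\<bar>x - y\<bar> powr \<alpha> \<le> 1"
      using dist_circle_le[of p q] xy(3) assms(3) by (intro powr_le1) auto
    then have "exp (A * \<bar>x - y\<bar> powr \<alpha>) \<le> exp A"
      using assms(2) by (simp add: mult_left_le)
    then have "h q * exp (A * \<bar>x - y\<bar> powr \<alpha>) \<le> h q * exp A"
      using less_imp_le[OF holder_densityD(2)[OF h]] by (rule mult_left_mono)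
    then show ?thesis
      using holder_densityD(4)[OF h, of x y] xy by simp
  qed
  note int = holder_densityD(5)[OF h]
  have "(LINT q|circle_lebesgue. h p) \<le> (LINT q|circle_lebesgue. h q * exp A)"
    using int by (intro integral_mono le) auto
  then show "h p \<le> exp A"
    using circle_lebesgue.prob_space holder_densityD(3)[OF h] by simp
  have "(LINT q|circle_lebesgue. h q) \<le> (LINT q|circle_lebesgue. h p * exp A)"
    using int by (intro integral_mono le) auto
  then show "exp (- A) \<le> h p"
    using circle_lebesgue.prob_space holder_densityD(3)[OF h] by (simp add: exp_minus field_simps)
qed

lemma mass_holder_density_le:
  assumes h: "holder_density \<alpha> A h" and "0 \<le> A" "0 \<le> \<alpha>" and B: "B \<in> sets borel"
  shows "mass h B \<le> exp A * measure circle_lebesgue B"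
proof -
  have "mass h B \<le> mass (\<lambda>p. exp A) B"
    by (rule mass_mono) (use holder_densityD(5)[OF h] holder_density_bounds[OF assms(1-3)] B in auto)
  then show ?thesis by (simp add: mass_const B)
qed

text \<open>A constant can be split off a density at the price of a larger Hoelder constant; the admissible
  amount comes from convexity of \<open>exp\<close>, which bounds \<open>exp (A' s)\<close> by the chord of \<open>exp (A s)\<close>.\<close>

definition coupling_const :: "real \<Rightarrow> real \<Rightarrow> real" where
  "coupling_const A' A = exp (- A) * (1 - A' / A)"

lemma coupling_const_bounds:
  assumes "0 \<le> A'" "A' < A"
  shows "0 < coupling_const A' A" "coupling_const A' A < 1" "coupling_const A' A \<le> exp (- A)"
proof -
  have "0 < 1 - A' / A" "1 - A' / A \<le> 1" using assms by (auto simp: field_simps)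
  then show 1: "0 < coupling_const A' A" "coupling_const A' A \<le> exp (- A)"
    by (auto simp: coupling_const_def)
  have "exp (- A) < 1" using assms by simp
  then show "coupling_const A' A < 1" using 1(2) by linarith
qed

lemma exp_chord:
  fixes A A' t :: real
  assumes "0 \<le> A'" "A' \<le> A" "0 < A"
  shows "exp (A' * t) \<le> A' / A * exp (A * t) + (1 - A' / A)"
proof -
  have "exp ((1 - A' / A) *\<^sub>R 0 + (A' / A) *\<^sub>R (A * t)) \<le> (1 - A' / A) * exp 0 + A' / A * exp (A * t)"
    by (rule convex_onD[OF exp_convex]) (use assms in auto)
  then show ?thesis using assms by (simp add: algebra_simps)
qed

text \<open>The remainder satisfies the Hoelder condition once \<open>c * (exp (A * t) - 1)\<close>
  is at most \<open>h (to_circle y) * (exp (A * t) - exp (A' * t))\<close>. The lower bound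
  \<open>exp (- A)\<close> on \<open>h\<close> and the chord inequality provide exactly
  this.\<close>

lemma holder_density_split:
  assumes h: "holder_density \<alpha> A' h" and A: "0 \<le> A'" "A' < A" and "0 \<le> \<alpha>"
  defines "c \<equiv> coupling_const A' A"
  shows "holder_density \<alpha> A (\<lambda>p. (h p - c) / (1 - c))"
proof -
  have c: "0 < c" "c < 1" "c \<le> exp (- A)"
    unfolding c_def by (rule coupling_const_bounds[OF A])+
  have hA': "exp (- A') \<le> h p" for p
    by (rule holder_density_bounds(1)[OF h A(1) \<open>0 \<le> \<alpha>\<close>])
  have "0 < h p - c" for p
  proof -
    have "exp (- A) < exp (- A')" using A by simp
    then show ?thesis using c hA'[of p] by linarith
  qed
  moreover have "h (to_circle x) - c \<le> (h (to_circle y) - c) * exp (A * t)"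
    if t: "t = \<bar>x - y\<bar> powr \<alpha>" for x y t
  proof -
    have "c * (exp (A * t) - 1) = exp (- A) * ((1 - A' / A) * (exp (A * t) - 1))"
      by (simp add: c_def coupling_const_def)
    also have "\<dots> \<le> exp (- A) * (exp (A * t) - exp (A' * t))"
      using exp_chord[of A' A t] A by (intro mult_left_mono) (auto simp: algebra_simps)
    also have "\<dots> \<le> h (to_circle y) * (exp (A * t) - exp (A' * t))"
    proof (rule mult_right_mono)
      have "exp (- A) \<le> exp (- A')" using A by simp
      then show "exp (- A) \<le> h (to_circle y)" using hA'[of "to_circle y"] by linarith
      show "0 \<le> exp (A * t) - exp (A' * t)" using A t by (simp add: mult_right_mono)
    qed
    finally show ?thesis
      using holder_densityD(4)[OF h, of x y] t by (simp add: algebra_simps)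
  qed
  moreover have "(LINT p|circle_lebesgue. (h p - c) / (1 - c)) = 1"
    using holder_densityD(3,5)[OF h] c circle_lebesgue.prob_space by simp
  ultimately show ?thesis
    using holder_densityD(1)[OF h] c
    by (auto simp: holder_density_def divide_right_mono)
qed

section \<open>Contraction of the transfer operator on Hoelder densities\<close>

context expanding_lift
begin

text \<open>The factor by which the inverse \<open>G\<close> contracts distances raised to the power
  \<alpha>.\<close>

definition \<theta> :: real where "\<theta> = a powr (- \<alpha>)"

lemma \<theta>_bounds: "0 < \<theta>" "\<theta> < 1"
  using a_gt_1 \<alpha>_pos by (auto simp: \<theta>_def powr_less_one)

lemma mass_transfer:
  assumes [measurable]: "h \<in> borel_measurable borel" "B \<in> sets borel" and h: "\<And>p. 0 \<le> h p"
  shows "mass h (f -` B) = mass (transfer h) B"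
proof -
  have [measurable]: "f -` B \<in> sets borel"
    using measurable_sets[OF map_measurable, of B] by simp
  have mass: "mass g C = enn2real (\<integral>\<^sup>+p. indicator C p * ennreal (g p) \<partial>circle_lebesgue)"
    if [measurable]: "g \<in> borel_measurable borel" "C \<in> sets borel" and g: "\<And>p. 0 \<le> g p" for g C
  proof -
    have "mass g C = enn2real (\<integral>\<^sup>+p. ennreal (indicator C p * g p) \<partial>circle_lebesgue)"
      unfolding mass_def by (rule integral_eq_nn_integral) (auto simp: g)
    also have "(\<integral>\<^sup>+p. ennreal (indicator C p * g p) \<partial>circle_lebesgue) =
        (\<integral>\<^sup>+p. indicator C p * ennreal (g p) \<partial>circle_lebesgue)"
      by (intro nn_integral_cong) (auto split: split_indicator)
    finally show ?thesis .
  qed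
  have "(\<integral>\<^sup>+p. indicator (f -` B) p * ennreal (h p) \<partial>circle_lebesgue) =
      (\<integral>\<^sup>+p. indicator B (f p) * ennreal (h p) \<partial>circle_lebesgue)"
    by (intro nn_integral_cong) (auto split: split_indicator)
  also have "\<dots> = (\<integral>\<^sup>+p. indicator B p * ennreal (transfer h p) \<partial>circle_lebesgue)"
    by (rule nn_integral_transfer) (auto simp: h)
  finally show ?thesis
    by (simp add: mass h transfer_nonneg)
qed

text \<open>Along each branch \<open>h\<close> contributes \<open>A * s\<close> and the weight
  \<open>1 / F'\<close> contributes \<open>b * s\<close> to the logarithm, where \<open>s\<close> is
  the \<alpha>-th power of the distance of the preimages and shrinks by \<theta>. Sums over branches
  keep the bound.\<close>

lemma holder_density_transfer:
  assumes h: "holder_density \<alpha> A h" and "0 \<le> A"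
  shows "holder_density \<alpha> ((A + b) * \<theta>) (transfer h)"
proof -
  have branch_le: "branch h x \<le> branch h y * exp ((A + b) * \<theta> * \<bar>x - y\<bar> powr \<alpha>)" for x y
  proof -
    define s where "s = \<bar>G x - G y\<bar> powr \<alpha>"
    have "s \<le> (\<bar>x - y\<bar> / a) powr \<alpha>"
      unfolding s_def using G_contract \<alpha>_pos by (intro powr_mono2) auto
    also have "\<dots> = \<theta> * \<bar>x - y\<bar> powr \<alpha>"
      using a_gt_1 by (simp add: \<theta>_def powr_divide powr_minus_divide)
    finally have s: "s \<le> \<theta> * \<bar>x - y\<bar> powr \<alpha>" .
    have s_nonneg: "0 \<le> s" by (simp add: s_def)
    have "F' (G y) \<le> F' (G x) + b * s"
      using F'_holder[of "G y" "G x"] by (simp add: s_def abs_minus_commute)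
    \<comment> \<open>As \<open>F' \<ge> 1\<close>, the additive Hoelder bound on \<open>F'\<close>
      becomes a multiplicative one.\<close>
    also have "\<dots> \<le> F' (G x) + F' (G x) * (b * s)"
      using mult_right_mono[of 1 "F' (G x)" "b * s"] F'_ge[of "G x"] a_gt_1 b_gt_1 s_nonneg by simp
    also have "\<dots> = F' (G x) * (1 + b * s)" by (simp add: algebra_simps)
    also have "\<dots> \<le> F' (G x) * exp (b * s)"
      using exp_ge_add_one_self less_imp_le[OF F'_pos] by (intro mult_left_mono)
    finally have F': "1 / F' (G x) \<le> exp (b * s) / F' (G y)"
      using F'_pos[of "G x"] F'_pos[of "G y"] by (simp add: field_simps)
    have "branch h x = h (to_circle (G x)) * (1 / F' (G x))"
      by (simp add: branch_def)
    also have "\<dots> \<le> (h (to_circle (G y)) * exp (A * s)) * (exp (b * s) / F' (G y))"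
      using holder_densityD(4)[OF h, of "G x" "G y"] F' less_imp_le[OF holder_densityD(2)[OF h]]
        less_imp_le[OF F'_pos]
      by (intro mult_mono) (auto simp: s_def)
    also have "\<dots> = branch h y * exp ((A + b) * s)"
      by (simp add: branch_def distrib_right exp_add)
    also have "\<dots> \<le> branch h y * exp ((A + b) * (\<theta> * \<bar>x - y\<bar> powr \<alpha>))"
      using s b_gt_1 \<open>0 \<le> A\<close> holder_densityD(2)[OF h] F'_pos
      by (intro mult_left_mono) (auto simp: branch_def less_imp_le)
    finally show ?thesis by (simp add: mult.assoc)
  qed
  have "transfer h (to_circle x) \<le> transfer h (to_circle y) * exp ((A + b) * \<theta> * \<bar>x - y\<bar> powr \<alpha>)" for x y
    unfolding transfer_to_circle sum_distrib_right
  proof (rule sum_mono)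
    fix j
    show "branch h (x + real j) \<le> branch h (y + real j) * exp ((A + b) * \<theta> * \<bar>x - y\<bar> powr \<alpha>)"
      using branch_le[of "x + real j" "y + real j"] by simp
  qed
  moreover have "0 < transfer h p" for p
    unfolding transfer_def branch_def using d_pos holder_densityD(2)[OF h] F'_pos
    by (intro sum_pos divide_pos_pos) auto
  moreover have "(LINT p|circle_lebesgue. transfer h p) = 1"
    using mass_transfer[of h UNIV] holder_densityD(1-3)[OF h] by (simp add: mass_def less_imp_le)
  ultimately show ?thesis
    using holder_densityD(1)[OF h] by (simp add: holder_density_def)
qed

lemma iterate_measurable [measurable]: "f ^^ n \<in> borel_measurable borel"
  by (induction n) (auto intro: measurable_comp)

lemma iterate_vimage_measurable: "B \<in> sets borel \<Longrightarrow> (f ^^ n) -` B \<in> sets borel"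
  using measurable_sets[OF iterate_measurable, of B n] by simp

text \<open>The induction removes the iterate that acts first: after it, both densities contain the
  same multiple \<open>c\<close> of Lebesgue measure, which cancels, and the hypothesis is applied
  to the remainders. Hence it is generalized over \<open>g\<close> and \<open>h\<close>. The case
  \<open>n = 0\<close> only says that two probabilities differ by at most 1.\<close>

lemma mass_iterate_contract:
  assumes A: "0 < A" "(A + b) * \<theta> < A"
    and "holder_density \<alpha> A g" "holder_density \<alpha> A h" and B: "B \<in> sets borel"
  shows "\<bar>mass g ((f ^^ n) -` B) - mass h ((f ^^ n) -` B)\<bar> \<le> (1 - coupling_const ((A + b) * \<theta>) A) ^ n"
  using assms(3,4)
proof (induction n arbitrary: g h)
  case 0
  then show ?case
    using mass_holder_density[OF 0(1) B] mass_holder_density[OF 0(2) B] by simp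
next
  case (Suc n)
  let ?A = "(A + b) * \<theta>" and ?C = "(f ^^ n) -` B"
  define c where "c = coupling_const ?A A"
  have A': "0 \<le> ?A" using A b_gt_1 \<theta>_bounds by simp
  have c: "0 < c" "c < 1"
    unfolding c_def by (rule coupling_const_bounds[OF A' A(2)])+
  \<comment> \<open>The remainder after removing the constant \<open>c\<close> from the transferred
    density, rescaled to total mass 1.\<close>
  define S where "S h p = (transfer h p - c) / (1 - c)" for h p
  have C: "?C \<in> sets borel" by (rule iterate_vimage_measurable[OF B])
  have split: "holder_density \<alpha> A (S h) \<and>
      mass h ((f ^^ Suc n) -` B) = c * measure circle_lebesgue ?C + (1 - c) * mass (S h) ?C"
    if h: "holder_density \<alpha> A h" for h
  proof
    have "holder_density \<alpha> ?A (transfer h)"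
      using h A by (intro holder_density_transfer) auto
    then show S: "holder_density \<alpha> A (S h)"
      unfolding S_def c_def using A' A(2) \<alpha>_pos by (intro holder_density_split) auto
    have "transfer h = (\<lambda>p. c + (1 - c) * S h p)"
      using c by (simp add: S_def)
    moreover have "mass (\<lambda>p. c + (1 - c) * S h p) ?C = c * measure circle_lebesgue ?C + (1 - c) * mass (S h) ?C"
      using holder_densityD(5)[OF S] by (subst mass_add) (auto simp: C mass_const mass_cmult)
    moreover have "(f ^^ Suc n) -` B = f -` ?C" by (simp add: funpow_swap1 vimage_def)
    ultimately show "mass h ((f ^^ Suc n) -` B) = c * measure circle_lebesgue ?C + (1 - c) * mass (S h) ?C"
      using mass_transfer[OF holder_densityD(1)[OF h] C] holder_densityD(2)[OF h]
      by (simp add: less_imp_le)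
  qed
  have "\<bar>mass g ((f ^^ Suc n) -` B) - mass h ((f ^^ Suc n) -` B)\<bar> =
      (1 - c) * \<bar>mass (S g) ?C - mass (S h) ?C\<bar>"
    using split[OF Suc.prems(1)] split[OF Suc.prems(2)] c
    by (simp add: abs_mult right_diff_distrib[symmetric])
  also have "\<dots> \<le> (1 - c) * (1 - c) ^ n"
    using Suc.IH[of "S g" "S h"] split[OF Suc.prems(1)] split[OF Suc.prems(2)] c
    by (intro mult_left_mono) (auto simp: c_def)
  finally show ?case by (simp only: c_def power_Suc)
qed

end

section \<open>Density of the Hoelder densities in L^1\<close>

lemma L1_tendsto_zero:
  fixes s :: "nat \<Rightarrow> circle \<Rightarrow> real"
  assumes [measurable]: "\<And>j. s j \<in> borel_measurable borel" "g \<in> borel_measurable borel"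
    and w: "integrable circle_lebesgue w"
    and bound: "\<And>j p. \<bar>s j p - g p\<bar> \<le> w p"
    and lim: "\<And>p. (\<lambda>j. s j p) \<longlonglongrightarrow> g p"
  shows "(\<lambda>j. LINT p|circle_lebesgue. \<bar>s j p - g p\<bar>) \<longlonglongrightarrow> 0"
proof -
  have "(\<lambda>j. \<bar>s j p - g p\<bar>) \<longlonglongrightarrow> 0" for p
    using tendsto_rabs_zero[OF LIM_zero[OF lim[of p]]] .
  then have "(\<lambda>j. LINT p|circle_lebesgue. \<bar>s j p - g p\<bar>) \<longlonglongrightarrow> (LINT p|circle_lebesgue. 0)"
    by (intro integral_dominated_convergence[where w = w] w) (auto simp: bound)
  then show ?thesis by simp
qed

text \<open>Density, phrased as an induction rule. Indicators of closed sets are L^1 limits of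
  positive Lipschitz functions, which are multiples of Hoelder densities because
  \<open>\<alpha> \<le> 1\<close>; closed sets generate the Borel sets and are stable under
  intersection, so Dynkin's argument and simple functions finish.\<close>

lemma holder_density_dense [consumes 3, case_names holder lincomb lim]:
  fixes g :: "circle \<Rightarrow> real"
  assumes g: "integrable circle_lebesgue g" and \<alpha>: "0 < \<alpha>" "\<alpha> \<le> 1"
    and holder: "\<And>A h. 0 \<le> A \<Longrightarrow> holder_density \<alpha> A h \<Longrightarrow> P h"
    and lincomb: "\<And>g h s t. integrable circle_lebesgue g \<Longrightarrow> integrable circle_lebesgue h \<Longrightarrow>
      P g \<Longrightarrow> P h \<Longrightarrow> P (\<lambda>p. s * g p + t * h p)"
    and lim: "\<And>g s. (\<And>j. integrable circle_lebesgue (s j)) \<Longrightarrow> (\<And>j. P (s j)) \<Longrightarrow>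
      integrable circle_lebesgue g \<Longrightarrow>
      (\<lambda>j::nat. LINT p|circle_lebesgue. \<bar>s j p - g p\<bar>) \<longlonglongrightarrow> 0 \<Longrightarrow> P g"
  shows "P g"
proof -
  have P_const: "P (\<lambda>p. t)" for t
    using lincomb[of "\<lambda>p. 1" "\<lambda>p. 1" t 0] holder[OF _ holder_density_const, of 0] by simp
  have int_ind: "integrable circle_lebesgue (indicator B :: circle \<Rightarrow> real)" if "B \<in> sets borel" for B
    using that circle_lebesgue.emeasure_finite by (simp add: integrable_indicator_iff less_top[symmetric])
  have P_closed: "P (indicator S)" if S: "closed S" for S
  proof (cases "S = {}")
    case True
    then have "indicator S = (\<lambda>p. 0 :: real)" by auto
    then show ?thesis using P_const[of 0] by simp
  next
    case False
    define \<delta> where "\<delta> j = inverse (real (Suc j))" for j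
    \<comment> \<open>A ramp of slope at most \<open>1 / \<delta> j\<close> that decreases to the
      indicator of \<open>S\<close>, lifted by \<open>\<delta> j\<close> so that its logarithm is
      Lipschitz too.\<close>
    define \<phi> where "\<phi> j p = \<delta> j + max 0 (1 - infdist p S / \<delta> j)" for j p
    have \<delta>: "0 < \<delta> j" "\<delta> j \<le> 1" for j by (auto simp: \<delta>_def divide_simps)
    have \<phi>_bounds: "\<delta> j \<le> \<phi> j p" "\<phi> j p \<le> 2" for j p
    proof -
      have "0 \<le> infdist p S / \<delta> j"
        using \<delta>(1)[of j] infdist_nonneg[of p S] by (simp add: less_imp_le)
      then show "\<delta> j \<le> \<phi> j p" "\<phi> j p \<le> 2"
        using \<delta>(2)[of j] unfolding \<phi>_def by linarith+
    qed
    have S_meas [measurable]: "S \<in> sets borel" using S by simp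
    have [measurable]: "(\<lambda>p. infdist p S) \<in> borel_measurable borel"
      by (intro borel_measurable_continuous_onI continuous_intros)
    have \<phi>_meas [measurable]: "\<phi> j \<in> borel_measurable borel" for j
      unfolding \<phi>_def by measurable
    have "\<bar>\<phi> j p\<bar> \<le> 2" for j p
      using \<phi>_bounds[of j p] \<delta>(1)[of j] by linarith
    then have \<phi>_int: "integrable circle_lebesgue (\<phi> j)" for j
      by (intro circle_lebesgue.integrable_const_bound[where B = 2]) auto
    have P_\<phi>: "P (\<phi> j)" for j
    proof -
      define I where "I = (LINT p|circle_lebesgue. \<phi> j p)"
      have "(LINT p|circle_lebesgue. \<delta> j) \<le> I"
        unfolding I_def by (intro integral_mono \<phi>_int \<phi>_bounds) auto
      then have I: "0 < I"
        using circle_lebesgue.prob_space \<delta>(1)[of j] by simp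
      \<comment> \<open>Slope \<open>1 / \<delta> j\<close> of the ramp divided by its lower bound
        \<open>\<delta> j\<close>.\<close>
      define A where "A = 1 / (\<delta> j)\<^sup>2"
      have "\<phi> j (to_circle x) \<le> \<phi> j (to_circle y) * exp (A * \<bar>x - y\<bar> powr \<alpha>)" for x y
      proof -
        define s where "s = \<bar>x - y\<bar> powr \<alpha>"
        let ?d = "dist (to_circle x) (to_circle y)"
        have "?d \<le> s"
        proof (cases "\<bar>x - y\<bar> \<le> 1")
          case True
          then have "\<bar>x - y\<bar> powr 1 \<le> s"
            unfolding s_def using \<alpha> by (intro powr_mono') auto
          then show ?thesis using dist_to_circle_le[of x y] by simp
        next
          case False
          then have "1 \<le> s" unfolding s_def using \<alpha> by (intro ge_one_powr_ge_zero) auto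
          then show ?thesis using dist_circle_le[of "to_circle x" "to_circle y"] by linarith
        qed
        moreover have "infdist (to_circle y) S - infdist (to_circle x) S \<le> ?d"
          using infdist_triangle_abs[of "to_circle x" S "to_circle y"] by linarith
        ultimately have "infdist (to_circle y) S / \<delta> j - infdist (to_circle x) S / \<delta> j \<le> s / \<delta> j"
          using \<delta>(1)[of j] by (simp add: diff_divide_distrib[symmetric] divide_right_mono)
        moreover have "0 \<le> s / \<delta> j" using \<delta>(1)[of j] by (simp add: s_def)
        ultimately have "\<phi> j (to_circle x) \<le> \<phi> j (to_circle y) + s / \<delta> j"
          unfolding \<phi>_def by linarith
        also have "s / \<delta> j = \<delta> j * (A * s)"
          using \<delta>(1)[of j] by (simp add: A_def power2_eq_square)
        also have "\<dots> \<le> \<phi> j (to_circle y) * (A * s)"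
          by (intro mult_right_mono \<phi>_bounds) (simp add: A_def s_def)
        also have "\<phi> j (to_circle y) + \<phi> j (to_circle y) * (A * s) = \<phi> j (to_circle y) * (1 + A * s)"
          by (simp add: algebra_simps)
        also have "\<dots> \<le> \<phi> j (to_circle y) * exp (A * s)"
          using less_le_trans[OF \<delta>(1)[of j] \<phi>_bounds(1)]
          by (intro mult_left_mono exp_ge_add_one_self) (rule less_imp_le)
        finally show ?thesis by (simp add: s_def)
      qed
      then have "holder_density \<alpha> A (\<lambda>p. \<phi> j p / I)"
        using I less_le_trans[OF \<delta>(1)[of j] \<phi>_bounds(1)] \<phi>_int[of j] I_def[symmetric]
        by (auto simp: holder_density_def divide_right_mono)
      then have "P (\<lambda>p. \<phi> j p / I)"
        by (intro holder[of A]) (simp_all add: A_def)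
      then have "P (\<lambda>p. I * (\<phi> j p / I) + 0 * (\<phi> j p / I))"
        using \<phi>_int[of j] by (intro lincomb) auto
      then show ?thesis using I by simp
    qed
    have \<delta>_lim: "\<delta> \<longlonglongrightarrow> 0"
      unfolding \<delta>_def by (rule LIMSEQ_inverse_real_of_nat)
    have \<phi>_lim: "(\<lambda>j. \<phi> j p) \<longlonglongrightarrow> indicator S p" for p
    proof (cases "p \<in> S")
      case True
      then have "(\<lambda>j. \<phi> j p) = (\<lambda>j. \<delta> j + 1)" by (simp add: \<phi>_def)
      then show ?thesis using tendsto_add[OF \<delta>_lim tendsto_const[of 1]] True by simp
    next
      case pS: False
      then have "0 < infdist p S"
        using in_closed_iff_infdist_zero[OF S False, of p] infdist_nonneg[of p S] by linarith
      then have "eventually (\<lambda>j. \<delta> j < infdist p S) sequentially"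
        using \<delta>_lim by (rule order_tendstoD(2)[rotated])
      then have "eventually (\<lambda>j. \<delta> j = \<phi> j p) sequentially"
      proof eventually_elim
        case (elim j)
        then have "1 \<le> infdist p S / \<delta> j" using \<delta>(1)[of j] by simp
        then show ?case by (simp add: \<phi>_def)
      qed
      then have "(\<lambda>j. \<phi> j p) \<longlonglongrightarrow> 0" using \<delta>_lim by (rule Lim_transform_eventually[rotated])
      then show ?thesis using pS by simp
    qed
    have "\<bar>\<phi> j p - indicator S p\<bar> \<le> 3" for j p
      using \<phi>_bounds[of j p] less_imp_le[OF \<delta>(1)[of j]] by (auto split: split_indicator simp: abs_le_iff)
    then have "(\<lambda>j. LINT p|circle_lebesgue. \<bar>\<phi> j p - indicator S p\<bar>) \<longlonglongrightarrow> 0"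
      by (intro L1_tendsto_zero[where w = "\<lambda>p. 3"] \<phi>_lim) auto
    then show ?thesis
      by (rule lim[OF \<phi>_int P_\<phi> int_ind[OF S_meas]])
  qed
  have borel_eq: "sets (borel :: circle measure) = sigma_sets UNIV (Collect closed)"
    unfolding borel_eq_closed by simp
  have P_indicator: "P (indicator B)" if "B \<in> sets borel" for B
  proof -
    have "Int_stable (Collect closed :: circle set set)"
      by (auto simp: Int_stable_def)
    moreover have "Collect closed \<subseteq> Pow (UNIV :: circle set)" by simp
    moreover have "B \<in> sigma_sets UNIV (Collect closed)"
      using that by (simp only: borel_eq)
    ultimately show ?thesis
    proof (induction rule: sigma_sets_induct_disjoint)
      case (basic A)
      then show ?case using P_closed by simp
    next
      case empty
      show ?case using P_const[of 0] by simp
    next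
      case (compl A)
      have "indicator (UNIV - A) = (\<lambda>p. 1 * 1 + (- 1) * indicator A p :: real)"
        by (auto split: split_indicator)
      then show ?case
        using compl lincomb[of "\<lambda>p. 1" "indicator A" 1 "- 1"] P_const[of 1] int_ind[of A]
        by (simp only: borel_eq[symmetric]) simp
    next
      case (union A)
      have A [measurable]: "A i \<in> sets borel" for i using union(2) borel_eq by auto
      have 1: "P (\<lambda>p. \<Sum>i<n. indicator (A i) p)" for n
      proof (induction n)
        case 0
        show ?case using P_const[of 0] by simp
      next
        case (Suc n)
        then show ?case
          using lincomb[of "\<lambda>p. \<Sum>i<n. indicator (A i) p" "indicator (A n)" 1 1] union(3)[of n] int_ind[OF A]
          by simp
      qed
      \<comment> \<open>Disjointness makes the partial sums indicators, so their distance to the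
        limit is dominated by 1.\<close>
      have ind: "(\<Sum>i<n. indicator (A i) p) = (indicator (\<Union>i<n. A i) p :: real)" for n p
        using union(1) by (subst indicator_UN_disjoint) (auto intro: disjoint_family_on_mono)
      have "(\<lambda>n. indicator (\<Union>i<n. A i) p :: real) \<longlonglongrightarrow> indicator (\<Union>i. A i) p" for p
        by (rule LIMSEQ_indicator_UN)
      then have "(\<lambda>n. LINT p|circle_lebesgue. \<bar>(\<Sum>i<n. indicator (A i) p) - indicator (\<Union>i. A i) p :: real\<bar>) \<longlonglongrightarrow> 0"
        unfolding ind by (intro L1_tendsto_zero[where w = "\<lambda>p. 1"]) (auto split: split_indicator)
      moreover have "integrable circle_lebesgue (\<lambda>p. \<Sum>i<n. indicator (A i) p :: real)" for n
        by (intro Bochner_Integration.integrable_sum int_ind A)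
      moreover have "(\<Union>i. A i) \<in> sets borel" by measurable
      ultimately show ?case
        using lim[of "\<lambda>n p. \<Sum>i<n. indicator (A i) p" "indicator (\<Union>i. A i)"] 1 int_ind by blast
    qed
  qed
  from g show ?thesis
  proof (induction g)
    case (base B t)
    then show ?case
      using lincomb[of "indicator B" "indicator B" t 0] P_indicator[of B] int_ind[of B]
      by (simp add: mult.commute)
  next
    case (add g h)
    then show ?case using lincomb[of g h 1 1] by simp
  next
    case (lim g s)
    have int [measurable]: "integrable circle_lebesgue (s j)" "integrable circle_lebesgue g" for j
      by (rule lim)+
    have P: "P (s j)" for j by (rule lim)
    have "norm (s j p) \<le> 2 * norm (g p)" "(\<lambda>j. s j p) \<longlonglongrightarrow> g p" for j p
      using lim by simp_all
    note bound = this(1) and tendsto = this(2)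
    \<comment> \<open>The induction for integrable functions supplies approximants with
      \<open>\<bar>s j p\<bar> \<le> 2 * \<bar>g p\<bar>\<close>, whence the dominating function
      \<open>3 * \<bar>g p\<bar>\<close>.\<close>
    have "\<bar>s j p - g p\<bar> \<le> 3 * \<bar>g p\<bar>" for j p
      using bound[of j p] by simp
    then have "(\<lambda>j. LINT p|circle_lebesgue. \<bar>s j p - g p\<bar>) \<longlonglongrightarrow> 0"
      using borel_measurable_integrable[OF int(1)] borel_measurable_integrable[OF int(2)] int(2) tendsto
      by (intro L1_tendsto_zero[where w = "\<lambda>p. 3 * \<bar>g p\<bar>"]) auto
    then show ?case by (rule assms(6)[OF int(1) P int(2)])
  qed
qed

section \<open>The SRB measure\<close>

context expanding_lift
begin

text \<open>\<open>b * \<theta> / (1 - \<theta>)\<close> is the fixed point of the map taking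
  \<open>A\<close> to \<open>(A + b) * \<theta>\<close>. Adding 1 leaves a gap of exactly
  \<open>1 - \<theta>\<close> after one step, and this gap determines the mass that can be split
  off.\<close>

definition A\<^sub>f :: real where "A\<^sub>f = b * \<theta> / (1 - \<theta>) + 1"

lemma A\<^sub>f_pos: "0 < A\<^sub>f"
  using b_gt_1 \<theta>_bounds by (simp add: A\<^sub>f_def add_nonneg_pos)

lemma A\<^sub>f_contract: "(A\<^sub>f + b) * \<theta> = A\<^sub>f - (1 - \<theta>)"
  using \<theta>_bounds by (simp add: A\<^sub>f_def field_simps)

text \<open>The gap persists above \<open>A\<^sub>f\<close> because the map has slope
  \<open>\<theta> < 1\<close>. Larger constants occur when the initial density is an arbitrary
  Hoelder density.\<close>

lemma contract_ge_A\<^sub>f: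
  assumes "A\<^sub>f \<le> A"
  shows "0 < A" "0 \<le> (A + b) * \<theta>" "(A + b) * \<theta> < A"
proof -
  show "0 < A" using A\<^sub>f_pos assms by simp
  then show "0 \<le> (A + b) * \<theta>" using b_gt_1 \<theta>_bounds by simp
  have "(A\<^sub>f + b) * \<theta> + (A - A\<^sub>f) * \<theta> < A\<^sub>f + (A - A\<^sub>f) * 1"
    using A\<^sub>f_contract \<theta>_bounds assms by (intro add_less_le_mono mult_left_mono) auto
  then show "(A + b) * \<theta> < A" by (simp add: algebra_simps)
qed

definition c\<^sub>f :: real where "c\<^sub>f = coupling_const ((A\<^sub>f + b) * \<theta>) A\<^sub>f"

lemma c\<^sub>f_bounds: "0 < c\<^sub>f" "c\<^sub>f < 1"
  unfolding c\<^sub>f_def using contract_ge_A\<^sub>f[OF order_refl] by (auto intro: coupling_const_bounds)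

lemma c\<^sub>f_eq: "c\<^sub>f = exp (- A\<^sub>f) * ((1 - \<theta>) / A\<^sub>f)"
  using A\<^sub>f_pos by (simp add: c\<^sub>f_def coupling_const_def A\<^sub>f_contract diff_divide_distrib)

definition image_mass :: "nat \<Rightarrow> circle set \<Rightarrow> real" where
  "image_mass n B = measure circle_lebesgue ((f ^^ n) -` B)"

definition image_density :: "nat \<Rightarrow> circle \<Rightarrow> real" where
  "image_density n = (transfer ^^ n) (\<lambda>p. 1)"

lemma holder_density_image: "holder_density \<alpha> A\<^sub>f (image_density n)"
proof (induction n)
  case 0
  show ?case using A\<^sub>f_pos by (simp add: image_density_def holder_density_const)
next
  case (Suc n)
  have "holder_density \<alpha> ((A\<^sub>f + b) * \<theta>) (transfer (image_density n))"
    using Suc A\<^sub>f_pos by (intro holder_density_transfer) auto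
  then show ?case
    using holder_density_mono contract_ge_A\<^sub>f[OF order_refl] by (simp add: image_density_def less_imp_le)
qed

lemma image_mass_eq: "B \<in> sets borel \<Longrightarrow> image_mass n B = mass (image_density n) B"
proof (induction n arbitrary: B)
  case 0
  then show ?case by (simp add: image_mass_def image_density_def mass_const[where t = 1, simplified])
next
  case (Suc n)
  have "f -` B \<in> sets borel" using measurable_sets[OF map_measurable, of B] Suc.prems by simp
  then have "image_mass n (f -` B) = mass (image_density n) (f -` B)" by (rule Suc.IH)
  also have "\<dots> = mass (transfer (image_density n)) B"
    using holder_densityD(1,2)[OF holder_density_image] Suc.prems by (intro mass_transfer) (auto simp: less_imp_le)
  finally show ?case by (simp add: image_mass_def image_density_def vimage_def)
qed

lemma image_mass_vimage: "image_mass m ((f ^^ n) -` B) = image_mass (n + m) B"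
  by (simp add: image_mass_def vimage_def funpow_add)

text \<open>A bound independent of \<open>n\<close>. It survives in the limit, where it gives
  absolute continuity and countable additivity, and it controls the points that an iterate sends
  close to the end of an arc.\<close>

lemma image_mass_le: "B \<in> sets borel \<Longrightarrow> image_mass n B \<le> exp A\<^sub>f * measure circle_lebesgue B"
  using image_mass_eq[of B n] mass_holder_density_le[OF holder_density_image] A\<^sub>f_pos \<alpha>_pos by simp

text \<open>The contraction is applied to the density 1 and to its \<open>m\<close>-th image;
  \<open>n\<close> further steps turn them into the \<open>n\<close>-th and the
  \<open>(n + m)\<close>-th image of Lebesgue measure.\<close>

lemma image_mass_diff:
  assumes B: "B \<in> sets borel"
  shows "\<bar>image_mass n B - image_mass (n + m) B\<bar> \<le> (1 - c\<^sub>f) ^ n"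
proof -
  have "\<bar>mass (image_density 0) ((f ^^ n) -` B) - mass (image_density m) ((f ^^ n) -` B)\<bar> \<le> (1 - c\<^sub>f) ^ n"
    unfolding c\<^sub>f_def
    by (intro mass_iterate_contract holder_density_image B) (use contract_ge_A\<^sub>f[OF order_refl] in auto)
  then show ?thesis
    using image_mass_eq[OF iterate_vimage_measurable[OF B, of n], of 0]
      image_mass_eq[OF iterate_vimage_measurable[OF B, of n], of m]
    by (simp add: image_mass_vimage)
qed

definition limit_mass :: "circle set \<Rightarrow> real" where
  "limit_mass B = lim (\<lambda>n. image_mass n B)"

lemma image_mass_tendsto:
  assumes B: "B \<in> sets borel"
  shows "(\<lambda>n. image_mass n B) \<longlonglongrightarrow> limit_mass B"
proof -
  have "Cauchy (\<lambda>n. image_mass n B)"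
    unfolding Cauchy_altdef
  proof (intro allI impI)
    fix e :: real assume "0 < e"
    then obtain N where N: "(1 - c\<^sub>f) ^ N < e"
      using c\<^sub>f_bounds real_arch_pow_inv[of e "1 - c\<^sub>f"] by auto
    have "dist (image_mass m B) (image_mass n B) < e" if "N \<le> m" "m < n" for m n
    proof -
      have "dist (image_mass m B) (image_mass n B) \<le> (1 - c\<^sub>f) ^ m"
        using image_mass_diff[OF B, of m "n - m"] that by (simp add: dist_real_def)
      also have "\<dots> \<le> (1 - c\<^sub>f) ^ N"
        using that c\<^sub>f_bounds by (intro power_decreasing) auto
      finally show ?thesis using N by simp
    qed
    then show "\<exists>M. \<forall>m\<ge>M. \<forall>n>m. dist (image_mass m B) (image_mass n B) < e" by blast
  qed
  then show ?thesis
    unfolding limit_mass_def by (simp add: Cauchy_convergent convergent_LIMSEQ_iff[symmetric])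
qed

lemma image_mass_limit_diff:
  assumes B: "B \<in> sets borel"
  shows "\<bar>image_mass n B - limit_mass B\<bar> \<le> (1 - c\<^sub>f) ^ n"
proof (rule LIMSEQ_le_const2)
  have "(\<lambda>m. image_mass (m + n) B) \<longlonglongrightarrow> limit_mass B"
    by (rule LIMSEQ_ignore_initial_segment[OF image_mass_tendsto[OF B]])
  then show "(\<lambda>m. \<bar>image_mass n B - image_mass (m + n) B\<bar>) \<longlonglongrightarrow> \<bar>image_mass n B - limit_mass B\<bar>"
    by (intro tendsto_rabs tendsto_diff tendsto_const)
  show "\<exists>N. \<forall>m\<ge>N. \<bar>image_mass n B - image_mass (m + n) B\<bar> \<le> (1 - c\<^sub>f) ^ n"
    using image_mass_diff[OF B, of n] by (metis add.commute)
qed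

lemma limit_mass_bounds:
  assumes B: "B \<in> sets borel"
  shows "0 \<le> limit_mass B" "limit_mass B \<le> exp A\<^sub>f * measure circle_lebesgue B" "limit_mass B \<le> 1"
proof -
  show "0 \<le> limit_mass B"
    by (rule LIMSEQ_le_const[OF image_mass_tendsto[OF B]]) (simp add: image_mass_def)
  show "limit_mass B \<le> exp A\<^sub>f * measure circle_lebesgue B"
    by (rule LIMSEQ_le_const2[OF image_mass_tendsto[OF B]]) (simp add: image_mass_le B)
  show "limit_mass B \<le> 1"
    by (rule LIMSEQ_le_const2[OF image_mass_tendsto[OF B]]) (simp add: image_mass_def)
qed

lemma limit_mass_UNIV: "limit_mass UNIV = 1"
  using LIMSEQ_unique[OF image_mass_tendsto[of UNIV], of 1] circle_lebesgue.prob_space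
  by (simp add: image_mass_def)

lemma limit_mass_vimage:
  assumes B: "B \<in> sets borel"
  shows "limit_mass (f -` B) = limit_mass B"
proof -
  have "f -` B \<in> sets borel" using measurable_sets[OF map_measurable, of B] B by simp
  then have "(\<lambda>n. image_mass n (f -` B)) \<longlonglongrightarrow> limit_mass (f -` B)" by (rule image_mass_tendsto)
  moreover have "image_mass n (f -` B) = image_mass (Suc n) B" for n
    using image_mass_vimage[of n 1 B] by simp
  ultimately show ?thesis
    using LIMSEQ_Suc[OF image_mass_tendsto[OF B]] LIMSEQ_unique by simp
qed

lemma limit_mass_additive:
  assumes B: "B \<in> sets borel" "C \<in> sets borel" "B \<inter> C = {}"
  shows "limit_mass (B \<union> C) = limit_mass B + limit_mass C"
proof -
  have "image_mass n (B \<union> C) = image_mass n B + image_mass n C" for n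
    unfolding image_mass_def vimage_Un
    by (rule circle_lebesgue.finite_measure_Union) (use B iterate_vimage_measurable in auto)
  then have "(\<lambda>n. image_mass n (B \<union> C)) \<longlonglongrightarrow> limit_mass B + limit_mass C"
    using B by (auto intro: tendsto_add image_mass_tendsto)
  then show ?thesis
    using image_mass_tendsto[of "B \<union> C"] B LIMSEQ_unique by blast
qed

definition limit_measure :: "circle measure" where
  "limit_measure = measure_of UNIV (sets borel) (\<lambda>B. ennreal (limit_mass B))"

lemma sets_limit_measure [simp]: "sets limit_measure = sets borel"
  unfolding limit_measure_def using sets.sigma_sets_eq[of "borel :: circle measure"] by simp

lemma space_limit_measure [simp]: "space limit_measure = UNIV"
  by (simp add: limit_measure_def space_measure_of_conv)

text \<open>A setwise limit is clearly finitely additive. Countable additivity reduces to continuity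
  at the empty set, which follows from domination by a multiple of Lebesgue measure.\<close>

lemma emeasure_limit_measure:
  assumes B: "B \<in> sets borel"
  shows "emeasure limit_measure B = ennreal (limit_mass B)"
  unfolding limit_measure_def
proof (rule emeasure_measure_of_sigma[OF _ _ _ B])
  show sa: "sigma_algebra UNIV (sets (borel :: circle measure))"
    using sets.sigma_algebra_axioms[of "borel :: circle measure"] by simp
  have empty: "limit_mass {} = 0"
    using limit_mass_bounds(1,2)[of "{}"] by simp
  show pos: "positive (sets borel) (\<lambda>B. ennreal (limit_mass B))"
    by (simp add: positive_def empty)
  interpret ring_of_sets UNIV "sets (borel :: circle measure)"
    by (intro algebra.axioms(1) sigma_algebra.axioms(1) sa)
  show "countably_additive (sets borel) (\<lambda>B. ennreal (limit_mass B))"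
  proof (rule empty_continuous_imp_countably_additive[OF pos])
    show "additive (sets borel) (\<lambda>B. ennreal (limit_mass B))"
      using limit_mass_bounds(1) by (simp add: additive_def limit_mass_additive)
    fix A :: "nat \<Rightarrow> circle set"
    assume A: "range A \<subseteq> sets borel" "decseq A" "(\<Inter>i. A i) = {}"
    have "(\<lambda>i. measure circle_lebesgue (A i)) \<longlonglongrightarrow> 0"
      using circle_lebesgue.finite_Lim_measure_decseq[of A] A by simp
    then have "(\<lambda>i. exp A\<^sub>f * measure circle_lebesgue (A i)) \<longlonglongrightarrow> 0"
      by (rule tendsto_mult_right_zero)
    then have "(\<lambda>i. limit_mass (A i)) \<longlonglongrightarrow> 0"
      by (rule Lim_null_comparison[OF always_eventually, rotated])
        (use A(1) limit_mass_bounds in \<open>auto simp: abs_of_nonneg\<close>)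
    then show "(\<lambda>i. ennreal (limit_mass (A i))) \<longlonglongrightarrow> 0"
      using tendsto_ennrealI by fastforce
  qed simp
qed

lemma measure_limit_measure: "B \<in> sets borel \<Longrightarrow> measure limit_measure B = limit_mass B"
  by (simp add: measure_def emeasure_limit_measure limit_mass_bounds)

text \<open>For Hoelder densities this is the coupling estimate, and it passes to limits in \<open>L\<^sup>1\<close>
  because pushing forward does not increase the total mass.\<close>

lemma mass_iterate_tendsto:
  assumes "integrable circle_lebesgue g" and B: "B \<in> sets borel"
  shows "(\<lambda>n. mass g ((f ^^ n) -` B)) \<longlonglongrightarrow> limit_mass B * (LINT p|circle_lebesgue. g p)"
  using assms(1) \<alpha>_pos \<alpha>_le_1
proof (induction rule: holder_density_dense)
  case (holder A h)
  \<comment> \<open>Large enough to put \<open>h\<close> and the constant density 1 into one class.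
    The rate now depends on \<open>h\<close>, which is harmless as only convergence is
    claimed.\<close>
  define A' where "A' = max A A\<^sub>f"
  note A' = contract_ge_A\<^sub>f[of A', unfolded A'_def, OF max.cobounded2, folded A'_def]
  define c where "c = coupling_const ((A' + b) * \<theta>) A'"
  have c: "0 < c" "c < 1" unfolding c_def using A' by (auto intro: coupling_const_bounds)
  have h: "holder_density \<alpha> A' h" "holder_density \<alpha> A' (image_density 0)"
    using holder_density_mono[OF holder(2), of A'] holder_density_mono[OF holder_density_image, of A' 0]
    by (simp_all add: A'_def)
  have bound: "\<bar>mass h ((f ^^ n) -` B) - image_mass n B\<bar> \<le> (1 - c) ^ n" for n
    using mass_iterate_contract[OF A'(1,3) h B, of n] image_mass_vimage[of 0 n B]
      image_mass_eq[OF iterate_vimage_measurable[OF B, of n], of 0]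
    by (simp add: c_def)
  have "(\<lambda>n. (1 - c) ^ n) \<longlonglongrightarrow> 0" using c by (intro LIMSEQ_realpow_zero) auto
  then have "(\<lambda>n. mass h ((f ^^ n) -` B) - image_mass n B) \<longlonglongrightarrow> 0"
    by (rule Lim_null_comparison[OF always_eventually, rotated]) (simp add: bound)
  from tendsto_add[OF this image_mass_tendsto[OF B]] show ?case
    using holder_densityD(3)[OF holder(2)] by simp
next
  case (lincomb g h s t)
  have "mass (\<lambda>p. s * g p + t * h p) ((f ^^ n) -` B) =
      s * mass g ((f ^^ n) -` B) + t * mass h ((f ^^ n) -` B)" for n
    using lincomb(1,2) iterate_vimage_measurable[OF B] by (simp add: mass_add mass_cmult)
  moreover have "(\<lambda>n. s * mass g ((f ^^ n) -` B) + t * mass h ((f ^^ n) -` B)) \<longlonglongrightarrow>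
      s * (limit_mass B * (LINT p|circle_lebesgue. g p)) + t * (limit_mass B * (LINT p|circle_lebesgue. h p))"
    by (intro tendsto_intros lincomb)
  ultimately show ?case
    using lincomb(1,2) by (simp add: algebra_simps)
next
  case (lim g s)
  have int: "integrable circle_lebesgue (s j)" "integrable circle_lebesgue g" for j
    by (rule lim)+
  have IH: "(\<lambda>n. mass (s j) ((f ^^ n) -` B)) \<longlonglongrightarrow> limit_mass B * (LINT p|circle_lebesgue. s j p)" for j
    by (rule lim)
  have "(\<lambda>j. LINT p|circle_lebesgue. \<bar>s j p - g p\<bar>) \<longlonglongrightarrow> 0"
    by (rule lim)
  note L1 = order_tendstoD(2)[OF this]
  show ?case
  proof (rule LIMSEQ_I)
    fix e :: real assume "0 < e"
    then obtain j where j: "(LINT p|circle_lebesgue. \<bar>s j p - g p\<bar>) < e / 3"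
      using L1[of "e / 3"] by (auto dest: eventually_happens)
    obtain N where N: "\<And>n. n \<ge> N \<Longrightarrow>
        \<bar>mass (s j) ((f ^^ n) -` B) - limit_mass B * (LINT p|circle_lebesgue. s j p)\<bar> < e / 3"
      using LIMSEQ_D[OF IH[of j], of "e / 3"] \<open>0 < e\<close> by auto
    \<comment> \<open>Uniform in \<open>n\<close>, so the approximant \<open>s j\<close> can be
      fixed before \<open>n\<close> grows.\<close>
    have 1: "\<bar>mass (s j) ((f ^^ n) -` B) - mass g ((f ^^ n) -` B)\<bar> < e / 3" for n
      using mass_abs_le[of "\<lambda>p. s j p - g p" "(f ^^ n) -` B"] j int iterate_vimage_measurable[OF B]
      by (simp add: mass_diff)
    have "\<bar>limit_mass B * (LINT p|circle_lebesgue. s j p) - limit_mass B * (LINT p|circle_lebesgue. g p)\<bar>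
        = limit_mass B * \<bar>LINT p|circle_lebesgue. s j p - g p\<bar>"
      using int limit_mass_bounds(1)[OF B] by (simp add: right_diff_distrib[symmetric] abs_mult)
    also have "\<dots> \<le> 1 * (LINT p|circle_lebesgue. \<bar>s j p - g p\<bar>)"
      using limit_mass_bounds[OF B] by (intro mult_mono integral_abs_bound) auto
    finally have 2: "\<bar>limit_mass B * (LINT p|circle_lebesgue. s j p) -
        limit_mass B * (LINT p|circle_lebesgue. g p)\<bar> < e / 3"
      using j by simp
    have "norm (mass g ((f ^^ n) -` B) - limit_mass B * (LINT p|circle_lebesgue. g p)) < e"
      if "n \<ge> N" for n
      using N[OF that] 1[of n] 2 by (simp add: abs_if split: if_splits)
    then show "\<exists>no. \<forall>n\<ge>no. norm (mass g ((f ^^ n) -` B) - limit_mass B * (LINT p|circle_lebesgue. g p)) < e"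
      by blast
  qed
qed

text \<open>For uniqueness, a competitor has a Radon-Nikodym density \<open>D\<close>. By invariance
  the \<open>D\<close>-mass of the iterated preimages of \<open>B\<close> is constant, while by
  mixing it tends to \<open>limit_mass B\<close>.\<close>

lemma srb_measure_eq: "srb_measure f = limit_measure"
  unfolding srb_measure_def
proof (rule the_equality, intro conjI)
  show "sets limit_measure = sets borel" by simp
  show "prob_space limit_measure"
    by standard (simp add: emeasure_limit_measure limit_mass_UNIV)
  show "distr limit_measure borel f = limit_measure"
  proof (rule measure_eqI)
    fix B assume "B \<in> sets (distr limit_measure borel f)"
    then have B: "B \<in> sets borel" by simp
    have "f -` B \<in> sets borel" using measurable_sets[OF map_measurable, of B] B by simp
    moreover have "f \<in> measurable limit_measure borel"
      using map_measurable by (simp cong: measurable_cong_sets)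
    ultimately show "emeasure (distr limit_measure borel f) B = emeasure limit_measure B"
      using B by (simp add: emeasure_distr emeasure_limit_measure limit_mass_vimage)
  qed simp
  show "absolutely_continuous circle_lebesgue limit_measure"
    unfolding absolutely_continuous_def
  proof
    fix B assume B: "B \<in> null_sets circle_lebesgue"
    then have "measure circle_lebesgue B = 0" by (simp add: null_sets_def measure_def)
    then have "limit_mass B \<le> 0" using limit_mass_bounds(2)[of B] B by auto
    then show "B \<in> null_sets limit_measure"
      using B by (auto simp: null_sets_def emeasure_limit_measure ennreal_neg)
  qed
next
  fix \<mu> :: "circle measure"
  assume \<mu>: "sets \<mu> = sets borel \<and> prob_space \<mu> \<and> distr \<mu> borel f = \<mu> \<and>
    absolutely_continuous circle_lebesgue \<mu>"
  then interpret \<mu>: prob_space \<mu> by simp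
  have sets_\<mu>: "sets \<mu> = sets borel" using \<mu> by simp
  have ac: "absolutely_continuous circle_lebesgue \<mu>" "sets \<mu> = sets circle_lebesgue"
    using \<mu> by simp_all
  obtain D where D [measurable]: "D \<in> borel_measurable circle_lebesgue"
    and RN: "AE p in circle_lebesgue. RN_deriv circle_lebesgue \<mu> p = ennreal (D p)"
    and "AE p in \<mu>. 0 < D p" and D_nonneg: "\<And>p. 0 \<le> D p"
    using circle_lebesgue.real_RN_deriv[OF \<mu>.finite_measure_axioms ac] by blast
  have "density circle_lebesgue (RN_deriv circle_lebesgue \<mu>) = \<mu>"
    using \<mu> by (intro circle_lebesgue.density_RN_deriv) auto
  moreover have "density circle_lebesgue (RN_deriv circle_lebesgue \<mu>) = density circle_lebesgue D"
    using RN by (intro density_cong) auto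
  ultimately have \<mu>_D: "\<mu> = density circle_lebesgue D" by simp
  have em: "emeasure \<mu> B = (\<integral>\<^sup>+p. ennreal (indicator B p * D p) \<partial>circle_lebesgue)" if "B \<in> sets borel" for B
    using that unfolding \<mu>_D
    by (subst emeasure_density) (auto intro!: nn_integral_cong split: split_indicator)
  have mass_D: "measure \<mu> B = mass D B" if [measurable]: "B \<in> sets borel" for B
    unfolding mass_def measure_def em[OF that]
    by (rule integral_eq_nn_integral[symmetric]) (auto simp: D_nonneg)
  have "space \<mu> = UNIV" using sets_eq_imp_space_eq[OF sets_\<mu>] by simp
  then have int_D: "(LINT p|circle_lebesgue. D p) = 1"
    using mass_D[of UNIV] \<mu>.prob_space by (simp add: mass_def)
  then have "integrable circle_lebesgue D"
    using not_integrable_integral_eq[of circle_lebesgue D] by auto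
  have inv: "measure \<mu> ((f ^^ n) -` B) = measure \<mu> B" if B: "B \<in> sets borel" for n B
  proof (induction n)
    case (Suc n)
    let ?C = "(f ^^ n) -` B"
    have "f \<in> measurable \<mu> borel"
      using map_measurable by (simp add: sets_\<mu> cong: measurable_cong_sets)
    moreover have "?C \<in> sets borel" by (rule iterate_vimage_measurable[OF B])
    ultimately have "measure (distr \<mu> borel f) ?C = measure \<mu> (f -` ?C)"
      using \<open>space \<mu> = UNIV\<close> by (simp add: measure_distr)
    moreover have "(f ^^ Suc n) -` B = f -` ?C" by (simp add: funpow_swap1 vimage_def)
    ultimately show ?case using \<mu> Suc by (simp only:)
  qed simp
  show "\<mu> = limit_measure"
  proof (rule measure_eqI)
    fix B assume "B \<in> sets \<mu>"
    then have B: "B \<in> sets borel" by (simp add: sets_\<mu>)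
    have "(\<lambda>n. mass D ((f ^^ n) -` B)) \<longlonglongrightarrow> limit_mass B"
      using mass_iterate_tendsto[OF \<open>integrable circle_lebesgue D\<close> B] int_D by simp
    moreover have "mass D ((f ^^ n) -` B) = measure \<mu> B" for n
      using mass_D[OF iterate_vimage_measurable[OF B]] inv[OF B] by simp
    ultimately have "measure \<mu> B = limit_mass B"
      by (simp add: LIMSEQ_const_iff)
    then show "emeasure \<mu> B = emeasure limit_measure B"
      by (simp add: \<mu>.emeasure_eq_measure emeasure_limit_measure B)
  qed (simp add: sets_\<mu>)
qed

end

section \<open>Discretizations\<close>

lemma cramer_dist_le:
  assumes H: "\<And>x. 0 \<le> x \<Longrightarrow> x \<le> 1 \<Longrightarrow> \<bar>circle_cdf \<mu> x - circle_cdf \<nu> x - c\<bar> \<le> \<epsilon>" and "0 \<le> \<epsilon>"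
  shows "cramer_dist \<mu> \<nu> \<le> \<epsilon>"
proof -
  define I where "I c = (LBINT x:{0..1}. (circle_cdf \<mu> x - circle_cdf \<nu> x - c)\<^sup>2)" for c
  have nonneg: "0 \<le> I c" for c
    unfolding I_def set_lebesgue_integral_def by (intro integral_nonneg_AE) simp
  have "I c \<le> \<epsilon>\<^sup>2"
  proof (cases "set_integrable lborel {0..1} (\<lambda>x. (circle_cdf \<mu> x - circle_cdf \<nu> x - c)\<^sup>2)")
    case True
    have "I c \<le> (LBINT x:{0..1::real}. \<epsilon>\<^sup>2)"
      unfolding I_def
    proof (rule set_integral_mono[OF True])
      show "set_integrable lborel {0..1::real} (\<lambda>x. \<epsilon>\<^sup>2)"
        by (simp add: set_integrable_def)
      show "(circle_cdf \<mu> x - circle_cdf \<nu> x - c)\<^sup>2 \<le> \<epsilon>\<^sup>2" if "x \<in> {0..1}" for x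
        using H[of x] that \<open>0 \<le> \<epsilon>\<close> by (simp add: abs_le_square_iff[symmetric])
    qed
    then show ?thesis by (simp add: set_lebesgue_integral_def)
  next
    case False
    \<comment> \<open>A non-integrable function has integral 0 by convention, which respects the
      bound.\<close>
    then have "I c = 0"
      unfolding I_def set_lebesgue_integral_def set_integrable_def by (rule not_integrable_integral_eq)
    then show ?thesis by simp
  qed
  moreover have "(INF c. I c) \<le> I c"
    by (rule cINF_lower) (auto intro!: bdd_belowI[of _ 0] nonneg)
  ultimately have "(INF c. I c) \<le> \<epsilon>\<^sup>2" by (rule order_trans[rotated])
  then have "sqrt (INF c. I c) \<le> sqrt (\<epsilon>\<^sup>2)" by (rule real_sqrt_le_mono)
  then show ?thesis using \<open>0 \<le> \<epsilon>\<close> by (simp add: cramer_dist_def I_def)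
qed

text \<open>The difference of two distribution functions oscillates by at most 1.\<close>

lemma cramer_dist_le_half:
  assumes \<mu>: "prob_space \<mu>" "sets \<mu> = sets borel" and \<nu>: "prob_space \<nu>" "sets \<nu> = sets borel"
  shows "cramer_dist \<mu> \<nu> \<le> 1 / 2"
proof -
  define H where "H x = circle_cdf \<mu> x - circle_cdf \<nu> x" for x
  have mono: "0 \<le> circle_cdf M x \<and> circle_cdf M x \<le> circle_cdf M y \<and> circle_cdf M y \<le> 1"
    if "prob_space M" "sets M = sets borel" "x \<le> y" for M x y
  proof -
    interpret prob_space M by fact
    have "circle_cdf M x \<le> circle_cdf M y"
      unfolding circle_cdf_def using that(2,3) borel_closed[OF closed_coord_le]
      by (intro finite_measure_mono) auto
    then show ?thesis by (simp add: circle_cdf_def)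
  qed
  \<comment> \<open>Between two points both distribution functions increase by an amount in
    \<open>[0, 1]\<close>, so these increments differ by at most 1.\<close>
  have osc: "H x \<le> H y + 1" for x y
    using mono[OF \<mu>, of "min x y" "max x y"] mono[OF \<nu>, of "min x y" "max x y"]
    by (cases "x \<le> y") (auto simp: H_def min_def max_def)
  then have bdd: "bdd_above (range H)" by (intro bdd_aboveI[of _ "H 0 + 1"]) auto
  show ?thesis
  proof (rule cramer_dist_le)
    fix x :: real
    have "H x \<le> (SUP x. H x)" by (rule cSUP_upper[OF UNIV_I bdd])
    moreover have "(SUP x. H x) \<le> H x + 1" by (rule cSUP_least) (auto intro: osc)
    \<comment> \<open>The shift \<open>(SUP x. H x) - 1 / 2\<close> centres the range of
      \<open>H\<close>, an interval of length at most 1.\<close>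
    ultimately show "\<bar>circle_cdf \<mu> x - circle_cdf \<nu> x - ((SUP x. H x) - 1 / 2)\<bar> \<le> 1 / 2"
      unfolding H_def[symmetric] abs_le_iff by linarith
  qed simp
qed

section \<open>Coupling the grid with Lebesgue measure\<close>

lemma (in finite_measure) measure_diff_le:
  assumes "U \<in> sets M" "V \<in> sets M" "W \<in> sets M" "U - V \<subseteq> W" "V - U \<subseteq> W"
  shows "\<bar>measure M U - measure M V\<bar> \<le> measure M W"
proof -
  have "measure M U \<le> measure M (V \<union> W)" "measure M V \<le> measure M (U \<union> W)"
    using assms by (auto intro!: finite_measure_mono)
  moreover have "measure M (V \<union> W) \<le> measure M V + measure M W" "measure M (U \<union> W) \<le> measure M U + measure M W"
    using assms by (auto intro!: measure_Un_le)
  ultimately show ?thesis by linarith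
qed

text \<open>Rounding down has fibres of measure exactly \<open>1 / N\<close>, so a Lebesgue random
  point \<open>p\<close> yields a uniform grid point within \<open>1 / N\<close> of
  \<open>p\<close>. Ties in \<open>P N\<close> never enter.\<close>

definition grid_floor :: "nat \<Rightarrow> circle \<Rightarrow> circle" where
  "grid_floor N p = to_circle (of_int \<lfloor>real N * circle_coord p\<rfloor> / real N)"

definition grid_cell :: "nat \<Rightarrow> nat \<Rightarrow> circle set" where
  "grid_cell N i = circle_coord -` {real i / real N..<(real i + 1) / real N}"

lemma in_grid_cell_iff:
  assumes "N \<ge> 1"
  shows "p \<in> grid_cell N i \<longleftrightarrow> \<lfloor>real N * circle_coord p\<rfloor> = int i"
proof -
  have "p \<in> grid_cell N i \<longleftrightarrow> real i \<le> real N * circle_coord p \<and> real N * circle_coord p < real i + 1"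
    using assms by (auto simp: grid_cell_def field_simps)
  then show ?thesis by (simp add: floor_eq_iff)
qed

lemma grid_cell_cover:
  assumes "N \<ge> 1"
  obtains i where "i < N" "p \<in> grid_cell N i"
proof
  let ?i = "nat \<lfloor>real N * circle_coord p\<rfloor>"
  have nonneg: "0 \<le> \<lfloor>real N * circle_coord p\<rfloor>"
    using circle_coord_bounds[of p] by simp
  then show "p \<in> grid_cell N ?i" by (simp add: in_grid_cell_iff[OF assms])
  have "real N * circle_coord p < real N"
    using circle_coord_bounds[of p] assms by simp
  then have "\<lfloor>real N * circle_coord p\<rfloor> < int N" by (simp add: floor_less_iff)
  then show "?i < N" using nonneg by linarith
qed

lemma grid_floor_cell:
  "N \<ge> 1 \<Longrightarrow> p \<in> grid_cell N i \<Longrightarrow> grid_floor N p = to_circle (real i / real N)"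
  by (simp add: in_grid_cell_iff grid_floor_def)

lemma grid_floor_in_grid: "N \<ge> 1 \<Longrightarrow> grid_floor N p \<in> grid N"
  using grid_cell_cover[of N p] grid_floor_cell[of N p] by (auto simp: grid_def)

lemma dist_grid_floor:
  assumes "N \<ge> 1"
  shows "dist (grid_floor N p) p \<le> 1 / real N"
proof -
  let ?m = "of_int \<lfloor>real N * circle_coord p\<rfloor> :: real"
  have "dist (grid_floor N p) p \<le> \<bar>?m / real N - circle_coord p\<bar>"
    using dist_to_circle_le[of "?m / real N" "circle_coord p"] by (simp add: grid_floor_def)
  also have "\<dots> = \<bar>?m - real N * circle_coord p\<bar> / real N"
  proof -
    have "?m / real N - circle_coord p = (?m - real N * circle_coord p) / real N"
      using assms by (simp add: diff_divide_distrib)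
    then show ?thesis by simp
  qed
  also have "\<dots> \<le> 1 / real N"
    using assms floor_correct[of "real N * circle_coord p"] by (intro divide_right_mono) linarith+
  finally show ?thesis .
qed

lemma grid_cell_measurable: "grid_cell N i \<in> sets borel"
  unfolding grid_cell_def using measurable_sets[OF circle_coord_measurable, of "{real i / real N..<(real i + 1) / real N}"]
  by simp

lemma measure_grid_cell:
  assumes "N \<ge> 1" "i < N"
  shows "measure circle_lebesgue (grid_cell N i) = 1 / real N"
proof -
  have "real i + 1 \<le> real N" using assms by linarith
  then have "(real i + 1) / real N \<le> 1" using assms by (simp add: divide_le_eq)
  then have "{real i / real N..<(real i + 1) / real N} \<inter> {0..<1} = {real i / real N..<(real i + 1) / real N}"
    using assms by (auto intro: order_trans[rotated])
  then have "emeasure circle_lebesgue (grid_cell N i) = ennreal (1 / real N)"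
    using assms by (simp add: grid_cell_def emeasure_circle_lebesgue_coord divide_right_mono diff_divide_distrib[symmetric])
  then show ?thesis by (simp add: measure_def)
qed

lemma inj_on_grid: "inj_on (\<lambda>i. to_circle (real i / real N)) {..<N}"
proof (rule inj_onI)
  have coord: "circle_coord (to_circle (real i / real N)) = real i / real N" if "i < N" for i
    unfolding circle_coord_to_circle frac_eq using that by simp
  fix i j assume ij: "i \<in> {..<N}" "j \<in> {..<N}" "to_circle (real i / real N) = to_circle (real j / real N)"
  then have "real i / real N = real j / real N" by (metis coord lessThan_iff)
  then show "i = j" using ij by simp
qed

lemma card_grid: "card (grid N) = N"
  unfolding grid_def card_image[OF inj_on_grid] by (rule card_lessThan)

text \<open>The condition depends only on the cell of \<open>p\<close>, so the set is a finite union
  of cells. It is thus Borel for arbitrary \<open>T\<close>, in particular for iterates of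
  \<open>P N \<circ> f\<close>.\<close>

lemma grid_floor_vimage:
  assumes "N \<ge> 1"
  shows "{p. T (grid_floor N p) \<in> B} = (\<Union>i\<in>{i. i < N \<and> T (to_circle (real i / real N)) \<in> B}. grid_cell N i)"
proof (intro set_eqI iffI)
  fix p assume p: "p \<in> {p. T (grid_floor N p) \<in> B}"
  obtain i where "i < N" "p \<in> grid_cell N i" by (rule grid_cell_cover[OF assms])
  then show "p \<in> (\<Union>i\<in>{i. i < N \<and> T (to_circle (real i / real N)) \<in> B}. grid_cell N i)"
    using p grid_floor_cell[OF assms] by auto
qed (use grid_floor_cell[OF assms] in auto)

lemma grid_floor_vimage_measurable: "N \<ge> 1 \<Longrightarrow> {p. T (grid_floor N p) \<in> B} \<in> sets borel"
  unfolding grid_floor_vimage by (intro sets.finite_UN grid_cell_measurable) auto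

lemma uniform_grid_measurable: "T \<in> measurable (uniform_count_measure (grid N)) borel"
  by (auto simp: measurable_def space_uniform_count_measure sets_uniform_count_measure)

text \<open>This couples the discretized images with the images of Lebesgue measure.\<close>

lemma measure_uniform_grid:
  assumes N: "N \<ge> 1" and B: "B \<in> sets borel"
  shows "measure (distr (uniform_count_measure (grid N)) borel T) B =
    measure circle_lebesgue {p. T (grid_floor N p) \<in> B}"
proof -
  let ?I = "{i. i < N \<and> T (to_circle (real i / real N)) \<in> B}"
  have fin: "finite (grid N)" by (simp add: grid_def)
  have "measure (distr (uniform_count_measure (grid N)) borel T) B =
      measure (uniform_count_measure (grid N)) (T -` B \<inter> grid N)"
    using measure_distr[OF uniform_grid_measurable B] by (simp add: space_uniform_count_measure)
  also have "\<dots> = real (card (T -` B \<inter> grid N)) / real N"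
    using fin by (subst measure_uniform_count_measure) (auto simp: card_grid)
  also have "T -` B \<inter> grid N = (\<lambda>i. to_circle (real i / real N)) ` ?I"
    by (auto simp: grid_def)
  also have "card \<dots> = card ?I"
    by (rule card_image[OF inj_on_subset[OF inj_on_grid]]) auto
  finally have 1: "measure (distr (uniform_count_measure (grid N)) borel T) B = real (card ?I) / real N" .
  have "disjoint_family_on (grid_cell N) ?I"
    using N by (auto simp: disjoint_family_on_def in_grid_cell_iff)
  then have "measure circle_lebesgue (\<Union>i\<in>?I. grid_cell N i) = (\<Sum>i\<in>?I. measure circle_lebesgue (grid_cell N i))"
    by (intro circle_lebesgue.finite_measure_finite_Union) (auto simp: grid_cell_measurable)
  also have "\<dots> = real (card ?I) / real N"
    using N by (simp add: measure_grid_cell)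
  finally show ?thesis using 1 by (simp add: grid_floor_vimage[OF N])
qed

text \<open>A neighbourhood of the two ends of the arc from 0 to \<open>x\<close>. The end 0 shows
  up twice in the coordinate, near 0 and near 1.\<close>

definition arc_boundary :: "real \<Rightarrow> real \<Rightarrow> circle set" where
  "arc_boundary \<delta> x = circle_coord -` ({x - \<delta>..x + \<delta>} \<union> {0..\<delta>} \<union> {1 - \<delta>..1})"

lemma arc_boundary_measurable: "arc_boundary \<delta> x \<in> sets borel"
  unfolding arc_boundary_def
  using measurable_sets[OF circle_coord_measurable, of "{x - \<delta>..x + \<delta>} \<union> {0..\<delta>} \<union> {1 - \<delta>..1}"] by simp

lemma measure_arc_boundary:
  assumes "0 \<le> \<delta>"
  shows "measure circle_lebesgue (arc_boundary \<delta> x) \<le> 4 * \<delta>"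
proof -
  let ?X = "{x - \<delta>..x + \<delta>}" and ?Y = "{0..\<delta>}" and ?Z = "{1 - \<delta>..1}"
  have "emeasure circle_lebesgue (arc_boundary \<delta> x) = emeasure lborel ((?X \<union> ?Y \<union> ?Z) \<inter> {0..<1})"
    unfolding arc_boundary_def by (rule emeasure_circle_lebesgue_coord) measurable
  also have "\<dots> \<le> emeasure lborel (?X \<union> ?Y \<union> ?Z)"
    by (rule emeasure_mono) auto
  also have "\<dots> \<le> emeasure lborel (?X \<union> ?Y) + emeasure lborel ?Z"
    by (rule emeasure_subadditive) auto
  also have "\<dots> \<le> emeasure lborel ?X + emeasure lborel ?Y + emeasure lborel ?Z"
    by (intro add_right_mono emeasure_subadditive) auto
  also have "\<dots> = ennreal (4 * \<delta>)"
    using assms by (simp add: ennreal_plus[symmetric] del: ennreal_plus)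
  finally show ?thesis
    using assms by (simp add: circle_lebesgue.emeasure_eq_measure)
qed

text \<open>If the nearest integer \<open>n\<close> to the coordinate difference is nonzero, the
  short way from \<open>q\<close> to \<open>q'\<close> passes through 0, so \<open>q\<close> is
  close to 0 or 1; otherwise \<open>x\<close> separates the two coordinates.\<close>

lemma in_arc_boundary:
  assumes "dist q q' \<le> \<delta>" and "(circle_coord q \<le> x) \<noteq> (circle_coord q' \<le> x)"
  shows "q \<in> arc_boundary \<delta> x"
proof -
  let ?c = "circle_coord q" and ?c' = "circle_coord q'"
  define n where "n = round (?c - ?c')"
  have n: "\<bar>?c - ?c' - of_int n\<bar> \<le> \<delta>"
    using assms(1) dist_to_circle[of ?c ?c'] by (simp add: n_def)
  note bounds = circle_coord_bounds[of q] circle_coord_bounds[of q']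
  consider "n \<le> - 1" | "n = 0" | "n \<ge> 1" by linarith
  then show ?thesis
  proof cases
    case 1
    then have "of_int n \<le> (- 1 :: real)" by linarith
    then show ?thesis using n bounds by (auto simp: arc_boundary_def)
  next
    case 2
    then show ?thesis using n assms(2) by (auto simp: arc_boundary_def abs_le_iff)
  next
    case 3
    then have "(1 :: real) \<le> of_int n" by linarith
    then show ?thesis using n bounds by (auto simp: arc_boundary_def)
  qed
qed

section \<open>The discretization error at a fixed time\<close>

context expanding_lift
begin

text \<open>Each step multiplies the error by at most \<open>b\<close> and adds a rounding error of
  at most \<open>1 / N\<close>; the initial error is also at most \<open>1 / N\<close>. Solving this
  recursion gives the geometric sum.\<close>

lemma dist_discretized_iterate:
  assumes P: "nearest_projection P" and N: "N \<ge> 1"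
  shows "dist ((f ^^ k) p) (((P N \<circ> f) ^^ k) (grid_floor N p)) \<le> (\<Sum>j\<le>k. b ^ j) / real N"
proof (induction k)
  case 0
  then show ?case using dist_grid_floor[OF N, of p] by (simp add: dist_commute)
next
  case (Suc k)
  let ?u = "(f ^^ k) p" and ?v = "((P N \<circ> f) ^^ k) (grid_floor N p)"
  \<comment> \<open>A nearest grid point is at least as near as the one obtained by rounding
    down.\<close>
  have "dist (f ?v) (P N (f ?v)) \<le> dist (f ?v) (grid_floor N (f ?v))"
    using P N grid_floor_in_grid[OF N] by (simp add: nearest_projection_def)
  also have "\<dots> \<le> 1 / real N" using dist_grid_floor[OF N, of "f ?v"] by (simp add: dist_commute)
  finally have "dist (f ?u) (P N (f ?v)) \<le> dist (f ?u) (f ?v) + 1 / real N"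
    using dist_triangle[of "f ?u" "P N (f ?v)" "f ?v"] by linarith
  moreover have "dist (f ?u) (f ?v) \<le> b * ((\<Sum>j\<le>k. b ^ j) / real N)"
    using dist_map_le[of ?u ?v] mult_left_mono[OF Suc, of b] b_gt_1 by linarith
  moreover have "b * ((\<Sum>j\<le>k. b ^ j) / real N) + 1 / real N = (\<Sum>j\<le>Suc k. b ^ j) / real N"
    by (subst sum.atMost_Suc_shift) (simp add: sum_distrib_left add_divide_distrib)
  ultimately have "dist (f ?u) (P N (f ?v)) \<le> (\<Sum>j\<le>Suc k. b ^ j) / real N" by linarith
  moreover have "((P N \<circ> f) ^^ Suc k) (grid_floor N p) = P N (f ?v)" "(f ^^ Suc k) p = f ?u"
    by simp_all
  ultimately show ?case by (simp only:)
qed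

text \<open>The true and the discretized orbit of \<open>p\<close> disagree about the arc only if
  \<open>f ^^ k\<close> sends \<open>p\<close> into the boundary region, whose preimage is small by
  the uniform density bound.\<close>

lemma cdf_discretized_image:
  assumes P: "nearest_projection P" and N: "N \<ge> 1"
  shows "\<bar>image_mass k {p. circle_coord p \<le> x} - circle_cdf (discretized_image P f N k) x\<bar>
    \<le> exp A\<^sub>f * (4 * ((\<Sum>j\<le>k. b ^ j) / real N))"
proof -
  let ?S = "{p. circle_coord p \<le> x}" and ?T = "(P N \<circ> f) ^^ k"
  define \<delta> where "\<delta> = (\<Sum>j\<le>k. b ^ j) / real N"
  have \<delta>: "0 \<le> \<delta>" using b_gt_1 by (auto simp: \<delta>_def intro!: divide_nonneg_nonneg sum_nonneg)
  let ?W = "(f ^^ k) -` arc_boundary \<delta> x"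
  have S: "?S \<in> sets borel" using borel_closed[OF closed_coord_le] by simp
  have W: "p \<in> ?W" if "((f ^^ k) p \<in> ?S) \<noteq> (?T (grid_floor N p) \<in> ?S)" for p
    using in_arc_boundary[OF dist_discretized_iterate[OF P N, of k p, folded \<delta>_def]] that
    by (simp only: mem_Collect_eq vimage_eq)
  have "circle_cdf (discretized_image P f N k) x = measure circle_lebesgue {p. ?T (grid_floor N p) \<in> ?S}"
    unfolding circle_cdf_def discretized_image_def by (rule measure_uniform_grid[OF N S])
  moreover have "\<bar>measure circle_lebesgue ((f ^^ k) -` ?S) - measure circle_lebesgue {p. ?T (grid_floor N p) \<in> ?S}\<bar>
      \<le> measure circle_lebesgue ?W"
  proof (rule circle_lebesgue.measure_diff_le)
    show "(f ^^ k) -` ?S - {p. ?T (grid_floor N p) \<in> ?S} \<subseteq> ?W"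
      "{p. ?T (grid_floor N p) \<in> ?S} - (f ^^ k) -` ?S \<subseteq> ?W"
      using W by (simp_all only: subset_eq Diff_iff mem_Collect_eq vimage_eq) blast+
  qed (use S grid_floor_vimage_measurable[OF N, of ?T ?S] in
      \<open>simp_all add: iterate_vimage_measurable arc_boundary_measurable\<close>)
  moreover have "measure circle_lebesgue ?W \<le> exp A\<^sub>f * (4 * \<delta>)"
    using order_trans[OF image_mass_le[OF arc_boundary_measurable] mult_left_mono[OF measure_arc_boundary[OF \<delta>] exp_ge_zero]]
    unfolding image_mass_def .
  ultimately show ?thesis unfolding image_mass_def \<delta>_def by linarith
qed

text \<open>Half of \<epsilon> pays for the distance to the SRB measure at time \<open>k\<close>,
  the other half for discretization. \<open>N\<^sub>0\<close> grows with \<open>k\<close> through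
  the geometric sum in \<open>E\<close>.\<close>

lemma cramer_dist_discretized_image:
  assumes P: "nearest_projection P" and "0 < \<epsilon>" and k: "(1 - c\<^sub>f) ^ k \<le> \<epsilon> / 2"
  shows "\<exists>N\<^sub>0. \<forall>N\<ge>N\<^sub>0. N \<ge> 1 \<longrightarrow> cramer_dist (srb_measure f) (discretized_image P f N k) \<le> \<epsilon>"
proof -
  define E where "E = exp A\<^sub>f * (4 * (\<Sum>j\<le>k. b ^ j))"
  obtain N\<^sub>0 :: nat where N\<^sub>0: "E / (\<epsilon> / 2) < real N\<^sub>0"
    using reals_Archimedean2 by blast
  have "cramer_dist (srb_measure f) (discretized_image P f N k) \<le> \<epsilon>" if N: "N \<ge> N\<^sub>0" "N \<ge> 1" for N
  proof (rule cramer_dist_le)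
    fix x :: real
    let ?S = "{p. circle_coord p \<le> x}"
    have S: "?S \<in> sets borel" using borel_closed[OF closed_coord_le] by simp
    have "E / (\<epsilon> / 2) < real N" using N\<^sub>0 N by linarith
    then have "E / real N < \<epsilon> / 2" using N \<open>0 < \<epsilon>\<close> by (simp add: field_simps)
    then have "\<bar>image_mass k ?S - circle_cdf (discretized_image P f N k) x\<bar> \<le> \<epsilon> / 2"
      using cdf_discretized_image[OF P N(2), of k x] by (simp add: E_def)
    moreover have "\<bar>image_mass k ?S - circle_cdf (srb_measure f) x\<bar> \<le> \<epsilon> / 2"
      using image_mass_limit_diff[OF S, of k] k
      by (simp add: circle_cdf_def srb_measure_eq measure_limit_measure[OF S])
    ultimately show "\<bar>circle_cdf (srb_measure f) x - circle_cdf (discretized_image P f N k) x - 0\<bar> \<le> \<epsilon>"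
      by linarith
  qed (use \<open>0 < \<epsilon>\<close> in simp)
  then show ?thesis by blast
qed

text \<open>The factor 2 in \<open>2 / c\<^sub>f\<close> yields
  \<open>(1 - c\<^sub>f) ^ k \<le> \<epsilon> * \<epsilon>\<close>, which is at most
  \<open>\<epsilon> / 2\<close> when \<open>\<epsilon> < 1 / 2\<close>. For larger \<epsilon> the
  universal bound 1/2 applies.\<close>

lemma cramer_dist_discretized_image_log:
  assumes P: "nearest_projection P" and "0 < \<epsilon>" and k: "real k \<ge> - (2 / c\<^sub>f) * ln \<epsilon>"
  shows "\<exists>N\<^sub>0. \<forall>N\<ge>N\<^sub>0. N \<ge> 1 \<longrightarrow> cramer_dist (srb_measure f) (discretized_image P f N k) \<le> \<epsilon>"
proof (cases "\<epsilon> < 1 / 2")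
  case True
  have "(1 - c\<^sub>f) ^ k \<le> exp (- c\<^sub>f) ^ k"
    using c\<^sub>f_bounds exp_ge_add_one_self[of "- c\<^sub>f"] by (intro power_mono) auto
  also have "\<dots> = exp (- (c\<^sub>f * real k))"
    by (simp add: exp_of_nat_mult[symmetric] mult.commute)
  also have "\<dots> \<le> exp (2 * ln \<epsilon>)"
  proof -
    have "- (2 / c\<^sub>f) * ln \<epsilon> * c\<^sub>f \<le> real k * c\<^sub>f"
      by (rule mult_right_mono[OF k less_imp_le[OF c\<^sub>f_bounds(1)]])
    moreover have "- (2 / c\<^sub>f) * ln \<epsilon> * c\<^sub>f = - (2 * ln \<epsilon>)"
      using c\<^sub>f_bounds(1) by simp
    ultimately have "- (c\<^sub>f * real k) \<le> 2 * ln \<epsilon>" by (subst mult.commute) linarith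
    then show ?thesis by (rule exp_le_cancel_iff[THEN iffD2])
  qed
  also have "\<dots> = \<epsilon> * \<epsilon>"
    by (simp only: mult_2 exp_add exp_ln[OF \<open>0 < \<epsilon>\<close>])
  also have "\<dots> \<le> \<epsilon> / 2"
    using mult_left_mono[of \<epsilon> "1 / 2" \<epsilon>] True \<open>0 < \<epsilon>\<close> by simp
  finally show ?thesis by (rule cramer_dist_discretized_image[OF P \<open>0 < \<epsilon>\<close>])
next
  case False
  have "cramer_dist (srb_measure f) (discretized_image P f N k) \<le> 1 / 2" if N: "N \<ge> 1" for N
  proof (rule cramer_dist_le_half)
    show "prob_space (srb_measure f)"
      unfolding srb_measure_eq by standard (simp add: emeasure_limit_measure limit_mass_UNIV)
    have "finite (grid N)" "grid N \<noteq> {}" using N by (auto simp: grid_def lessThan_empty_iff)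
    then show "prob_space (discretized_image P f N k)"
      unfolding discretized_image_def
      by (rule prob_space.prob_space_distr[OF prob_space_uniform_count_measure uniform_grid_measurable])
  qed (simp_all add: srb_measure_eq discretized_image_def)
  then show ?thesis using False by (meson linorder_not_less order_trans)
qed

end

section \<open>Lifts of expanding maps\<close>

lemma C_norm_ge_fun_deriv:
  assumes "C_fun s \<phi>" "i \<le> nat \<lfloor>s\<rfloor>"
  shows "\<bar>fun_deriv i \<phi> p\<bar> \<le> C_norm s \<phi>"
proof -
  have nonneg: "0 \<le> (SUP p. \<bar>fun_deriv j \<phi> p\<bar>)" if "j \<le> nat \<lfloor>s\<rfloor>" for j
    by (rule cSUP_upper2[OF fun_deriv_bdd[OF assms(1) that], of "to_circle 0"]) auto
  have "\<bar>fun_deriv i \<phi> p\<bar> \<le> (SUP p. \<bar>fun_deriv i \<phi> p\<bar>)"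
    by (rule cSUP_upper[OF UNIV_I fun_deriv_bdd[OF assms]])
  also have "\<dots> \<le> (\<Sum>i\<le>nat \<lfloor>s\<rfloor>. SUP p. \<bar>fun_deriv i \<phi> p\<bar>)"
    using assms(2) nonneg by (intro member_le_sum) auto
  also have "\<dots> \<le> C_norm s \<phi>"
  proof -
    have "0 \<le> holder_seminorm (frac s) (fun_deriv (nat \<lfloor>s\<rfloor>) \<phi>)" if "s \<notin> \<int>"
      unfolding holder_seminorm_def
      by (rule cSUP_upper2[OF holder_bdd[OF assms(1) that] circle_distinct_pair]) auto
    then show ?thesis by (simp add: C_norm_def)
  qed
  finally show ?thesis .
qed

lemma C_norm_ge_holder:
  assumes "C_fun s \<phi>" "s \<notin> \<int>"
  shows "\<bar>fun_deriv (nat \<lfloor>s\<rfloor>) \<phi> p - fun_deriv (nat \<lfloor>s\<rfloor>) \<phi> q\<bar> \<le> C_norm s \<phi> * dist p q powr frac s"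
proof (cases "p = q")
  case False
  let ?\<psi> = "fun_deriv (nat \<lfloor>s\<rfloor>) \<phi>"
  have "0 \<le> (SUP p. \<bar>fun_deriv j \<phi> p\<bar>)" if "j \<le> nat \<lfloor>s\<rfloor>" for j
    by (rule cSUP_upper2[OF fun_deriv_bdd[OF assms(1) that], of "to_circle 0"]) auto
  then have "holder_seminorm (frac s) ?\<psi> \<le> C_norm s \<phi>"
    using assms(2) by (auto simp: C_norm_def intro!: sum_nonneg)
  moreover have "\<bar>?\<psi> p - ?\<psi> q\<bar> / dist p q powr frac s \<le> holder_seminorm (frac s) ?\<psi>"
    using cSUP_upper[OF _ holder_bdd[OF assms], of "(p, q)"] False by (simp add: holder_seminorm_def)
  ultimately have "\<bar>?\<psi> p - ?\<psi> q\<bar> / dist p q powr frac s \<le> C_norm s \<phi>" by simp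
  then show ?thesis using False by (simp add: divide_le_eq)
qed simp

lemma fun_deriv_0: "fun_deriv 0 \<phi> = \<phi>"
  by (simp add: fun_deriv_def fun_eq_iff)

lemma C_fun_differentiable:
  assumes "C_fun s \<phi>" "nat \<lfloor>s\<rfloor> \<noteq> 0"
  shows "(\<phi> \<circ> to_circle) field_differentiable at x"
proof -
  have "\<forall>i < nat \<lfloor>s\<rfloor>. \<forall>x. (deriv ^^ i) (\<phi> \<circ> to_circle) field_differentiable at x"
    using assms(1) unfolding C_fun_def by (rule conjunct1)
  then have "(deriv ^^ 0) (\<phi> \<circ> to_circle) field_differentiable at x" using assms(2) by blast
  then show ?thesis by simp
qed

text \<open>For \<open>s < 1\<close> the Hoelder seminorm in the norm is that of \<phi> itself, with
  exponent \<open>s\<close>. For \<open>s \<ge> 1\<close> the norm bounds the first derivative,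
  hence is a Lipschitz constant.\<close>

lemma C_norm_ge_dist_powr:
  assumes \<phi>: "C_fun s \<phi>" and "0 < s"
  shows "\<bar>\<phi> p - \<phi> q\<bar> \<le> C_norm s \<phi> * dist p q powr (min 1 s)"
proof (cases "s < 1")
  case True
  have floor: "\<lfloor>s\<rfloor> = 0" using True \<open>0 < s\<close> by (simp add: floor_eq_iff)
  then have frac: "frac s = s" by (simp add: frac_def)
  then have "s \<notin> \<int>" using \<open>0 < s\<close> by (metis frac_eq_0_iff less_irrefl)
  from C_norm_ge_holder[OF \<phi> this, of p q] show ?thesis
    using True by (simp add: floor frac fun_deriv_0)
next
  case False
  then have 1: "1 \<le> nat \<lfloor>s\<rfloor>" by (simp add: le_nat_floor)
  define D where "D = deriv (\<phi> \<circ> to_circle)"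
  have deriv: "((\<phi> \<circ> to_circle) has_real_derivative D x) (at x)" for x
    unfolding D_def by (rule field_differentiable_derivI[OF C_fun_differentiable[OF \<phi>]]) (use False in simp)
  \<comment> \<open>The norm sees derivatives only at representatives in \<open>[0, 1)\<close>;
    periodicity carries the bound to the whole line.\<close>
  have "D (x + 1) = D x" for x
  proof -
    have "((\<lambda>x. (\<phi> \<circ> to_circle) (x + 1)) has_real_derivative D (x + 1)) (at x)"
      using deriv[of "x + 1"] by (simp only: DERIV_shift)
    moreover have "(\<lambda>x. (\<phi> \<circ> to_circle) (x + 1)) = \<phi> \<circ> to_circle"
      using to_circle_add_nat[of _ 1] by (auto simp: fun_eq_iff)
    ultimately show ?thesis using deriv[of x] DERIV_unique by metis
  qed
  then have D_frac: "D (frac x) = D x" for x by (rule periodic_frac)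
  have D_le: "\<bar>D x\<bar> \<le> C_norm s \<phi>" for x
    using C_norm_ge_fun_deriv[OF \<phi> 1, of "to_circle x"]
    by (simp add: fun_deriv_def circle_coord_to_circle D_def[symmetric] D_frac)
  have lip: "\<bar>(\<phi> \<circ> to_circle) x - (\<phi> \<circ> to_circle) y\<bar> \<le> C_norm s \<phi> * \<bar>x - y\<bar>" for x y
    using field_differentiable_bound[of UNIV "\<phi> \<circ> to_circle" D "C_norm s \<phi>" x y] deriv D_le by simp
  obtain x y where xy: "p = to_circle x" "q = to_circle y" "dist p q = \<bar>x - y\<bar>"
    by (rule circle_reps)
  then show ?thesis using lip[of x y] False by (simp add: min_def)
qed

text \<open>Distinct integers are at distance at least 1. Needed for the difference of two lifts and
  for the degree \<open>F (x + 1) - F x\<close>.\<close>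

lemma continuous_Ints_valued_constant:
  fixes g :: "real \<Rightarrow> real"
  assumes "continuous_on UNIV g" "\<And>x. g x \<in> \<int>"
  shows "g x = g 0"
proof -
  have "g constant_on UNIV"
  proof (rule continuous_discrete_range_constant[OF connected_UNIV assms(1)])
    fix x
    have "1 \<le> norm (g y - g x)" if "g y \<noteq> g x" for y
      using that Ints_diff[OF assms(2) assms(2), of y x] Ints_nonzero_abs_ge1[of "g y - g x"] by simp
    then show "\<exists>e>0. \<forall>y. y \<in> UNIV \<and> g y \<noteq> g x \<longrightarrow> e \<le> norm (g y - g x)"
      by (intro exI[of _ 1]) auto
  qed
  then show ?thesis by (auto simp: constant_on_def)
qed

lemma expanding_map_lift:
  assumes "r > 1" and f: "f \<in> expanding_maps r"
  obtains F F' d where "expanding_lift f F F' d (INF p. map_deriv f p)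
    (C_norm (r - 1) (map_deriv f)) (min 1 (r - 1))"
proof -
  define a where "a = (INF p. map_deriv f p)"
  define b where "b = C_norm (r - 1) (map_deriv f)"
  have C: "C_fun (r - 1) (map_deriv f)" and deriv_gt_1: "1 < map_deriv f p" for p
    using f by (auto simp: expanding_maps_def C_map_def)
  obtain F\<^sub>0 where F\<^sub>0: "is_lift f F\<^sub>0" "\<And>x. F\<^sub>0 field_differentiable at x"
    using f by (auto simp: expanding_maps_def C_map_def)
  \<comment> \<open>\<open>map_deriv\<close> differentiates this chosen lift. It differs from the
    differentiable lift \<open>F\<^sub>0\<close> by a constant, so it is differentiable
    itself.\<close>
  define F where "F = (SOME F. is_lift f F)"
  have F: "is_lift f F" unfolding F_def by (rule someI[of "is_lift f", OF F\<^sub>0(1)])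
  have contF: "continuous_on UNIV F" and liftF: "to_circle (F x) = f (to_circle x)" for x
    using F by (auto simp: is_lift_def)
  have "F x - F\<^sub>0 x \<in> \<int>" for x
    using F F\<^sub>0(1) by (simp add: is_lift_def to_circle_eq_iff[symmetric])
  moreover have "continuous_on UNIV (\<lambda>x. F x - F\<^sub>0 x)"
    using F F\<^sub>0(1) by (auto simp: is_lift_def intro!: continuous_intros)
  ultimately have "F x - F\<^sub>0 x = F 0 - F\<^sub>0 0" for x
    using continuous_Ints_valued_constant[of "\<lambda>x. F x - F\<^sub>0 x"] by blast
  then have F_eq: "F = (\<lambda>x. F\<^sub>0 x + (F 0 - F\<^sub>0 0))"
    by (simp add: fun_eq_iff algebra_simps)
  have "F field_differentiable at x" for x
    by (subst F_eq) (intro field_differentiable_add F\<^sub>0(2) field_differentiable_const)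
  then have deriv: "(F has_real_derivative deriv F x) (at x)" for x
    by (simp add: field_differentiable_derivI)
  have "F (x + 1) - F x \<in> \<int>" for x
    using liftF[of "x + 1"] liftF[of x] to_circle_add_nat[of x 1] by (simp add: to_circle_eq_iff[symmetric])
  moreover have "continuous_on UNIV (\<lambda>x. F (x + 1) - F x)"
    by (intro continuous_intros continuous_on_compose2[OF contF]) auto
  ultimately have deg: "F (x + 1) - F x = F 1 - F 0" for x
    using continuous_Ints_valued_constant[of "\<lambda>x. F (x + 1) - F x" x] by simp
  have F_add: "F (x + 1) = F x + (F 1 - F 0)" for x using deg[of x] by simp
  have "deriv F (x + 1) = deriv F x" for x
  proof -
    have "((\<lambda>x. F (x + 1)) has_real_derivative deriv F (x + 1)) (at x)"
      using deriv[of "x + 1"] by (simp only: DERIV_shift)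
    moreover have "((\<lambda>x. F (x + 1)) has_real_derivative deriv F x) (at x)"
      by (subst F_add) (auto intro!: derivative_eq_intros deriv)
    ultimately show ?thesis by (rule DERIV_unique)
  qed
  then have "deriv F (frac x) = deriv F x" for x by (rule periodic_frac)
  then have md: "map_deriv f (to_circle x) = deriv F x" for x
    by (simp add: map_deriv_def F_def[symmetric] circle_coord_to_circle)
  have lower: "a \<le> deriv F x" for x
    unfolding a_def md[symmetric]
    by (rule cINF_lower) (auto intro!: bdd_belowI[of _ 1] less_imp_le[OF deriv_gt_1])
  have upper: "deriv F x \<le> b" for x
    using C_norm_ge_fun_deriv[OF C, of 0 "to_circle x"] by (simp add: fun_deriv_0 md b_def)
  have "0 \<le> b" unfolding b_def by (rule C_norm_nonneg[OF C])
  have holder: "\<bar>deriv F x - deriv F y\<bar> \<le> b * \<bar>x - y\<bar> powr (min 1 (r - 1))" for x y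
  proof -
    have "\<bar>deriv F x - deriv F y\<bar> \<le> b * dist (to_circle x) (to_circle y) powr (min 1 (r - 1))"
      using C_norm_ge_dist_powr[OF C, of "to_circle x" "to_circle y"] \<open>r > 1\<close> by (simp add: md b_def)
    also have "\<dots> \<le> b * \<bar>x - y\<bar> powr (min 1 (r - 1))"
      using dist_to_circle_le \<open>0 \<le> b\<close> \<open>r > 1\<close> by (intro mult_left_mono powr_mono2) auto
    finally show ?thesis .
  qed
  \<comment> \<open>The strict inequality survives the infimum because the continuous derivative
    attains its minimum over a period.\<close>
  have "1 < a"
  proof -
    have "(map_deriv f \<circ> to_circle) field_differentiable at x" if "nat \<lfloor>r - 1\<rfloor> \<noteq> 0" for x
      by (rule C_fun_differentiable[OF C that])
    then have "continuous_on UNIV (map_deriv f \<circ> to_circle)" if "nat \<lfloor>r - 1\<rfloor> \<noteq> 0"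
      using that by (intro continuous_at_imp_continuous_on ballI field_differentiable_imp_continuous_at)
    moreover have "continuous_on UNIV (map_deriv f \<circ> to_circle)" if "nat \<lfloor>r - 1\<rfloor> = 0"
      using C unfolding C_fun_def that by simp
    ultimately have "continuous_on UNIV (map_deriv f \<circ> to_circle)" by blast
    then have "continuous_on {0..1} (map_deriv f \<circ> to_circle)"
      by (rule continuous_on_subset) simp
    then obtain x\<^sub>0 where x\<^sub>0: "\<And>x. x \<in> {0..1} \<Longrightarrow> (map_deriv f \<circ> to_circle) x\<^sub>0 \<le> (map_deriv f \<circ> to_circle) x"
      using continuous_attains_inf[of "{0..1::real}"] by fastforce
    have "map_deriv f (to_circle x\<^sub>0) \<le> a"
      unfolding a_def
    proof (rule cINF_greatest)
      fix p
      show "map_deriv f (to_circle x\<^sub>0) \<le> map_deriv f p"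
        using x\<^sub>0[of "circle_coord p"] circle_coord_bounds[of p] by simp
    qed simp
    then show ?thesis using deriv_gt_1[of "to_circle x\<^sub>0"] by linarith
  qed
  have "\<exists>z. F 1 - F 0 = (1 - 0) * deriv F z"
    using MVT2[of 0 1 F "deriv F"] deriv by auto
  then have "0 < F 1 - F 0" using lower \<open>1 < a\<close> by (metis diff_zero less_trans mult_1 order_less_le_trans zero_less_one)
  moreover obtain n where n: "F 1 - F 0 = of_int n"
    using \<open>\<And>x. F (x + 1) - F x \<in> \<int>\<close>[of 0] by (auto elim: Ints_cases)
  ultimately have "F (x + 1) = F x + real (nat n)" for x using F_add[of x] by simp
  then have "expanding_lift f F (deriv F) (nat n) a b (min 1 (r - 1))"
    using \<open>r > 1\<close> \<open>1 < a\<close> by unfold_locales (auto simp: liftF deriv lower upper holder)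
  then show thesis using that by (simp add: a_def b_def)
qed

text \<open>The constant \<open>c\<^sub>f\<close> as a function of numbers alone, so that
  \<open>C\<close> can be fixed before the map.\<close>

definition decay_rate :: "real \<Rightarrow> real \<Rightarrow> real \<Rightarrow> real" where
  "decay_rate \<alpha> a b = (let \<theta> = a powr (- \<alpha>); A = b * \<theta> / (1 - \<theta>) + 1 in exp (- A) * ((1 - \<theta>) / A))"

theorem corollary1p2:
  fixes r :: real
  assumes "r > 1"
  shows "\<exists>C :: real \<Rightarrow> real \<Rightarrow> real.
           (\<forall>a b. C a b > 1) \<and>
           (\<forall>P. nearest_projection P \<longrightarrow>
              generic (C_topology r) (\<lambda>f.
                \<forall>\<epsilon>>0. \<forall>k::nat.
                  real k \<ge> - C (INF p. map_deriv f p) (C_norm (r - 1) (map_deriv f)) * ln \<epsilon> \<longrightarrow>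
                  (\<exists>N\<^sub>0::nat. \<forall>N\<ge>N\<^sub>0. N \<ge> 1 \<longrightarrow>
                     cramer_dist (srb_measure f) (discretized_image P f N k) \<le> \<epsilon>)))"
proof -
  define \<alpha> where "\<alpha> = min 1 (r - 1)"
  \<comment> \<open>The maximum ensures \<open>C a b > 1\<close> for all real arguments. For values
    coming from an expanding map, \<open>0 < c\<^sub>f < 1\<close> makes the second entry the larger
    one.\<close>
  define C where "C a b = max 2 (2 / decay_rate \<alpha> a b)" for a b
  have "\<exists>N\<^sub>0::nat. \<forall>N\<ge>N\<^sub>0. N \<ge> 1 \<longrightarrow> cramer_dist (srb_measure f) (discretized_image P f N k) \<le> \<epsilon>"
    if P: "nearest_projection P" and f: "f \<in> expanding_maps r" and "0 < \<epsilon>"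
      and k: "real k \<ge> - C (INF p. map_deriv f p) (C_norm (r - 1) (map_deriv f)) * ln \<epsilon>" for P f \<epsilon> k
  proof -
    obtain F F' d where "expanding_lift f F F' d (INF p. map_deriv f p) (C_norm (r - 1) (map_deriv f)) \<alpha>"
      using expanding_map_lift[OF assms f] by (metis \<alpha>_def)
    then interpret expanding_lift f F F' d "INF p. map_deriv f p" "C_norm (r - 1) (map_deriv f)" \<alpha> .
    have "decay_rate \<alpha> (INF p. map_deriv f p) (C_norm (r - 1) (map_deriv f)) = c\<^sub>f"
      unfolding decay_rate_def Let_def c\<^sub>f_eq A\<^sub>f_def \<theta>_def ..
    moreover have "2 \<le> 2 / c\<^sub>f" using c\<^sub>f_bounds by (simp add: field_simps)
    ultimately have "C (INF p. map_deriv f p) (C_norm (r - 1) (map_deriv f)) = 2 / c\<^sub>f"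
      by (simp add: C_def)
    then show ?thesis
      using cramer_dist_discretized_image_log[OF P \<open>0 < \<epsilon>\<close>] k by simp
  qed
  then have "generic (C_topology r) (\<lambda>f. \<forall>\<epsilon>>0. \<forall>k::nat.
      real k \<ge> - C (INF p. map_deriv f p) (C_norm (r - 1) (map_deriv f)) * ln \<epsilon> \<longrightarrow>
      (\<exists>N\<^sub>0::nat. \<forall>N\<ge>N\<^sub>0. N \<ge> 1 \<longrightarrow> cramer_dist (srb_measure f) (discretized_image P f N k) \<le> \<epsilon>))"
    if "nearest_projection P" for P
    \<comment> \<open>The witness is the empty family of open dense sets, whose intersection with
      the space is the space itself, where the estimate has just been proved.\<close>
    unfolding generic_def using that by (intro exI[of _ "{}"]) (simp add: topspace_C_topology)
  moreover have "\<forall>a b. C a b > 1" by (simp add: C_def less_max_iff_disj)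
  ultimately show ?thesis by blast
qed

end
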